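(* Let $(\lambda_n)$ be a decreasing sequence of positive real numbers such that $$\lim_{n\to\infty} n^{7/4}(\lambda_{n-2}-\lambda_n)=0 \quad\text{and}\quad \lim_{n\to\infty} n^{1/4}\left(\frac{\lambda_{n-2}}{\lambda_n}-1\right)=0,$$ and suppose that $$\lim_{n\to\infty} n^{3/2}\lambda_n = L\in[0,+\infty].$$ Let $P_n$ be the monic polynomial of degree $n$ orthogonal with respect to the weight $e^{-x^4}$ on $\mathbb{R}$, and let $S_{n,\lambda_n}$ be the monic polynomial of degree $n$ minimizing $\langle Q,Q\rangle_{\lambda_n}=\int_{\mathbb{R}}Q(x)^2e^{-x^4}\,dx+\lambda_n\int_{\mathbb{R}}Q'(x)^2e^{-x^4}\,dx$ among all monic polynomials $Q$ of degree $n$. Then $$\lim_{n\to\infty}\frac{S_{n,\lambda_n}(z)}{P_n(z)}=\begin{cases}1 & \text{if } L=0,\\[4pt] \dfrac{1}{1-\left[\varphi\left(\frac{20L+3\sqrt{3}}{12L}\right)\right]^{-1}} & \text{if } 0<L<+\infty,\\[10pt] \dfrac{3}{2} & \text{if } L=+\infty,\end{cases}$$ uniformly on compact subsets of $\mathbb{C}\setminus\mathbb{R}$, where $\varphi(x)=x+\sqrt{x^2-1}$.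
   Context: All polynomials have real coefficients. For $\lambda>0$, $\langle P,Q\rangle_\lambda=\int_{\mathbb{R}}P(x)Q(x)e^{-x^4}\,dx+\lambda\int_{\mathbb{R}}P'(x)Q'(x)e^{-x^4}\,dx$ is an inner product on the space of polynomials; the monic polynomial of degree $n$ minimizing $\langle Q,Q\rangle_\lambda$ over monic polynomials $Q$ of degree $n$ is unique and equals the monic orthogonal polynomial of degree $n$ for $\langle\cdot,\cdot\rangle_\lambda$. In $\varphi(x)=x+\sqrt{x^2-1}$, evaluated here at real $x>1$, the square root is positive. "Decreasing" is understood in the non-strict sense (constant sequences are allowed). *)

theory Defs
  imports "HOL-Analysis.Analysis" "HOL-Computational_Algebra.Polynomial"
begin

definition freud_inner :: "real poly \<Rightarrow> real poly \<Rightarrow> real" where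
  "freud_inner P Q = (LINT x|lborel. poly P x * poly Q x * exp (- (x ^ 4)))"

definition sobolev_inner :: "real \<Rightarrow> real poly \<Rightarrow> real poly \<Rightarrow> real" where
  "sobolev_inner lam P Q = freud_inner P Q + lam * freud_inner (pderiv P) (pderiv Q)"

definition monic_of_degree :: "nat \<Rightarrow> real poly \<Rightarrow> bool" where
  "monic_of_degree n P \<longleftrightarrow> degree P = n \<and> lead_coeff P = 1"

definition monic_orthogonal :: "nat \<Rightarrow> real poly \<Rightarrow> bool" where
  "monic_orthogonal n P \<longleftrightarrow>
     monic_of_degree n P \<and> (\<forall>Q. degree Q < n \<longrightarrow> freud_inner P Q = 0)"

definition sobolev_minimizer :: "real \<Rightarrow> nat \<Rightarrow> real poly \<Rightarrow> bool" where
  "sobolev_minimizer lam n S \<longleftrightarrow>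
     monic_of_degree n S \<and>
     (\<forall>Q. monic_of_degree n Q \<longrightarrow> sobolev_inner lam S S \<le> sobolev_inner lam Q Q)"

definition joukowski_phi :: "real \<Rightarrow> real" where
  "joukowski_phi x = x + sqrt (x\<^sup>2 - 1)"

definition sobolev_ratio_limit :: "ereal \<Rightarrow> real" where
  "sobolev_ratio_limit L =
     (if L = 0 then 1
      else if L = \<infinity> then 3 / 2
      else (let l = real_of_ereal L
            in 1 / (1 - inverse (joukowski_phi ((20 * l + 3 * sqrt 3) / (12 * l))))))"

abbreviation cpoly :: "real poly \<Rightarrow> complex \<Rightarrow> complex" where
  "cpoly P z \<equiv> poly (map_poly complex_of_real P) z"

end

(* Write P_n for the monic orthogonal polynomials, c_n for their recurrence coefficients and
   h_n for their squared norms.  Integration by parts gives P_n' = n P_{n-1} + d_n P_{n-3}, so the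
   Sobolev Gram matrix of the P_n couples only P_n and P_{n-2}, and for each fixed l the Sobolev
   polynomials satisfy T_n = P_n - a_n T_{n-2}.  With tau_n the quotient of l n^2 h_{n-1} by the
   squared Sobolev norm of T_n, this yields two contracting recurrences with l as a parameter,
   1 / tau_n = 1 + beta_n (1 - tau_{n-2}) + c_n / (l n^2) and
   T_n / P_n = 1 + b_n (T_{n-2} / P_{n-2}), where beta_n -> 1/9 and b_n - tau_{n-2} / 3 -> 0.
   Their solutions at index n depend, up to a small error, only on the last few steps; on such a
   bounded window c_m / (l m^2) is asymptotically constant for l = lam n, so one passes to the
   fixed points.  The limits of beta_n and b_n need c_n ~ sqrt (n / 12), which follows from the
   string equation, and P_n / P_{n+1} -> 0 off the real axis, which follows from the
   Christoffel-Darboux identity. *)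

theory Submission
  imports Defs "HOL-Probability.Sinc_Integral" "HOL-Real_Asymp.Real_Asymp"
begin

section \<open>Integration against the Freud weight\<close>

text \<open>The parameter changes with \<open>n\<close>, so the minimizers do not come from one
  orthogonal system and need not be linked by a recurrence. Fixing \<open>l = lam n\<close> and
  following the recurrences of that \<open>l\<close> back from \<open>n\<close> avoids this,
  provided that the bounds on \<open>tau\<close> and on \<open>T_n / P_n\<close> are uniform in
  \<open>l\<close>; the far end of the window is forgotten because the contraction factors stay
  below 1. The constants come from \<open>c n ~ sqrt (n / 12)\<close>:
  \<open>16 / 12^2 = 1/9\<close> and \<open>4 / 12 = 1/3\<close>. The minus sign in the definition
  of \<open>T\<close> becomes a plus sign for the quotients, since
  \<open>c_{n+1} P_n = z P_{n+1} - P_{n+2}\<close> makes \<open>c_{n+1} P_n / P_{n+2}\<close> tend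
  to -1. If \<open>t\<close> is the limit of \<open>tau\<close>, the quotients tend to the fixed
  point \<open>1 / (1 - t/3)\<close> of \<open>x = 1 + t x / 3\<close>.\<close>

lemma poly_freud_tendsto_0:
  "((\<lambda>x. poly p x * exp (- (x ^ 4))) \<longlongrightarrow> (0::real)) at_infinity"
proof -
  have abs_top: "filterlim (\<lambda>x::real. \<bar>x\<bar>) at_top at_infinity"
    using filterlim_norm_at_top[where 'a=real] by (simp add: real_norm_def[abs_def])
  have monom: "((\<lambda>x::real. x ^ k * exp (- (x ^ 4))) \<longlongrightarrow> 0) at_infinity" for k
  proof (rule Lim_null_comparison)
    show "((\<lambda>x::real. \<bar>x\<bar> ^ k / exp \<bar>x\<bar>) \<longlongrightarrow> 0) at_infinity"
      by (rule filterlim_compose[OF tendsto_power_div_exp_0 abs_top])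
    have "eventually (\<lambda>x::real. 1 \<le> \<bar>x\<bar>) at_infinity"
      using abs_top by (auto simp: filterlim_at_top)
    then show "eventually (\<lambda>x::real. norm (x ^ k * exp (- (x ^ 4))) \<le> \<bar>x\<bar> ^ k / exp \<bar>x\<bar>) at_infinity"
    proof eventually_elim
      case (elim x)
      have "\<bar>x\<bar> ^ 1 \<le> \<bar>x\<bar> ^ 4" using elim by (intro power_increasing) auto
      then have "exp (- (x ^ 4)) \<le> exp (- \<bar>x\<bar>)" by simp
      then have "\<bar>x\<bar> ^ k * exp (- (x ^ 4)) \<le> \<bar>x\<bar> ^ k * exp (- \<bar>x\<bar>)"
        by (intro mult_left_mono) auto
      then show ?case by (simp add: abs_mult power_abs exp_minus field_simps)
    qed
  qed
  have "((\<lambda>x. \<Sum>i\<le>degree p. coeff p i * (x ^ i * exp (- (x ^ 4)))) \<longlongrightarrow> (\<Sum>i\<le>degree p. coeff p i * 0)) at_infinity"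
    by (intro tendsto_sum tendsto_mult tendsto_const monom)
  then show ?thesis
    by (simp add: poly_altdef sum_distrib_right mult.assoc)
qed

text \<open>Even after multiplication by \<open>1 + x^2\<close> the integrand is continuous and
  vanishes at infinity, hence is bounded; this dominates it by a multiple of the integrable
  \<open>1 / (1 + x^2)\<close>.\<close>

lemma integrable_poly_freud: "integrable lborel (\<lambda>x. poly p x * exp (- (x ^ 4)) :: real)"
proof -
  define f where "f = (\<lambda>x::real. poly ([:1,0,1:] * p) x * exp (- (x ^ 4)))"
  have "eventually (\<lambda>x. dist (f x) 0 < 1) at_infinity"
    using poly_freud_tendsto_0[of "[:1,0,1:] * p"] unfolding f_def by (rule tendstoD) simp
  then obtain B where B: "\<And>x. B \<le> norm x \<Longrightarrow> dist (f x) 0 < 1"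
    by (auto simp: eventually_at_infinity)
  have "continuous_on {-B..B} f" unfolding f_def by (intro continuous_intros)
  then have "bounded (f ` {-B..B})" by (intro compact_imp_bounded compact_continuous_image) auto
  then obtain C where C: "\<forall>y \<in> f ` {-B..B}. norm y \<le> C"
    unfolding bounded_iff by blast
  have bound: "norm (f x) \<le> max 1 C" for x
  proof (cases "B \<le> norm x")
    case True then show ?thesis using B[of x] by simp
  next
    case False then have "x \<in> {-B..B}" by auto
    then show ?thesis using C by (metis imageI max.coboundedI2)
  qed
  have i: "integrable lborel (\<lambda>x::real. max 1 C * inverse (1 + x^2))"
    using integrable_inverse_1_plus_square
    by (simp add: set_integrable_def)
  show ?thesis
  proof (rule Bochner_Integration.integrable_bound[OF i])
    show "AE x in lborel. norm (poly p x * exp (- (x ^ 4))) \<le> norm (max 1 C * inverse (1 + x\<^sup>2))"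
    proof (rule AE_I2)
      fix x :: real
      have p: "0 < 1 + x^2" by (simp add: add_pos_nonneg)
      have "f x = (1 + x^2) * (poly p x * exp (- (x ^ 4)))"
        by (simp add: f_def algebra_simps power2_eq_square)
      then have "(1 + x^2) * norm (poly p x * exp (- (x ^ 4))) \<le> max 1 C"
        using bound[of x] p by (simp only: norm_mult real_norm_def abs_of_pos)
      then have "norm (poly p x * exp (- (x ^ 4))) \<le> max 1 C / (1 + x\<^sup>2)"
        using p by (simp only: pos_le_divide_eq mult.commute)
      also have "\<dots> = norm (max 1 C * inverse (1 + x\<^sup>2))"
        using p by (simp add: divide_inverse abs_mult)
      finally show "norm (poly p x * exp (- (x ^ 4))) \<le> norm (max 1 C * inverse (1 + x\<^sup>2))" .
    qed
  qed (simp, intro borel_measurable_continuous_onI continuous_intros)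
qed

definition freud_moment :: "real poly \<Rightarrow> real" where
  "freud_moment p = (LINT x|lborel. poly p x * exp (- (x ^ 4)))"

lemma freud_inner_moment: "freud_inner p q = freud_moment (p * q)"
  by (simp add: freud_inner_def freud_moment_def)

lemma freud_moment_add: "freud_moment (p + q) = freud_moment p + freud_moment q"
  unfolding freud_moment_def
  by (simp add: distrib_right Bochner_Integration.integral_add[OF integrable_poly_freud integrable_poly_freud])

lemma freud_moment_smult: "freud_moment (smult a p) = a * freud_moment p"
  unfolding freud_moment_def by (simp add: mult.assoc)

text \<open>The derivative of \<open>p * exp (- (x ^ 4))\<close> integrates to 0, because this
  product vanishes at both ends of the line.\<close>

lemma freud_moment_pderiv: "freud_moment (pderiv p) = freud_moment (monom 4 3 * p)"
proof -
  define F where "F = (\<lambda>x. poly p x * exp (- (x ^ 4)) :: real)"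
  define f where "f = (\<lambda>x. poly (pderiv p - monom 4 3 * p) x * exp (- (x ^ 4)) :: real)"
  have F0: "(F \<longlongrightarrow> 0) at_top" "(F \<longlongrightarrow> 0) at_bot"
    unfolding F_def
    by (rule filterlim_mono[OF poly_freud_tendsto_0 order_refl],
        simp add: at_top_le_at_infinity at_bot_le_at_infinity)+
  have "(LBINT x=-\<infinity>..\<infinity>. f x) = 0 - 0"
  proof (rule interval_integral_FTC_integrable[where F = F])
    show "(F has_vector_derivative f x) (at x)" for x
      unfolding has_real_derivative_iff_has_vector_derivative[symmetric] F_def f_def
      by (auto intro!: derivative_eq_intros simp: poly_monom algebra_simps)
    show "isCont f x" for x
      unfolding f_def by (intro continuous_intros)
    show "set_integrable lborel (einterval (-\<infinity>) \<infinity>) f"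
      using integrable_poly_freud[of "pderiv p - monom 4 3 * p"]
      by (simp add: set_integrable_def f_def)
    show "((F \<circ> real_of_ereal) \<longlongrightarrow> 0) (at_right (-\<infinity>))"
      using F0 by (simp add: ereal_tendsto_simps)
    show "((F \<circ> real_of_ereal) \<longlongrightarrow> 0) (at_left \<infinity>)"
      using F0 by (simp add: ereal_tendsto_simps)
  qed simp
  then have "freud_moment (pderiv p - monom 4 3 * p) = 0"
    by (simp add: interval_lebesgue_integral_def set_lebesgue_integral_def freud_moment_def f_def)
  moreover have "pderiv p - monom 4 3 * p = pderiv p + smult (-1) (monom 4 3 * p)" by simp
  ultimately show ?thesis
    by (simp add: freud_moment_add freud_moment_smult del: smult_minus_left)
qed

lemma freud_moment_reflect: "freud_moment (pcompose p [:0, -1:]) = freud_moment p"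
  unfolding freud_moment_def
  by (subst (2) lborel_integral_real_affine[where c = "-1" and t = 0])
     (simp_all add: poly_pcompose)

lemma freud_inner_self_nonneg: "0 \<le> freud_inner p p"
  unfolding freud_inner_def by (rule Bochner_Integration.integral_nonneg) simp

text \<open>A vanishing integral makes \<open>p\<close> zero almost everywhere, whereas the finitely
  many roots of a nonzero polynomial form a null set.\<close>

lemma freud_inner_self_eq_0_iff: "freud_inner p p = 0 \<longleftrightarrow> p = 0"
proof
  assume "freud_inner p p = 0"
  then have "AE x in lborel. poly p x * poly p x * exp (- (x ^ 4)) = 0"
    using integrable_poly_freud[of "p * p"] unfolding freud_inner_def
    by (subst (asm) integral_nonneg_eq_0_iff_AE) auto
  then have "AE x in lborel. poly p x = 0" by simp
  show "p = 0"
  proof (rule ccontr)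
    assume "p \<noteq> 0"
    then have fin: "finite {x. poly p x = 0}" by (rule poly_roots_finite)
    then have "AE x in lborel. x \<notin> {x. poly p x = 0}"
      by (intro AE_not_in) (simp add: null_sets_def finite_imp_closed emeasure_lborel_countable countable_finite borel_closed)
    with \<open>AE x in lborel. poly p x = 0\<close> have "AE x in (lborel :: real measure). False"
      by eventually_elim auto
    then show False by (auto simp: eventually_False ae_filter_eq_bot_iff)
  qed
qed (simp add: freud_inner_def)

lemma freud_inner_self_pos: "p \<noteq> 0 \<Longrightarrow> 0 < freud_inner p p"
  using freud_inner_self_nonneg[of p] freud_inner_self_eq_0_iff[of p] by linarith

lemma freud_moment_diff: "freud_moment (p - q) = freud_moment p - freud_moment q"
  using freud_moment_add[of p "smult (-1) q"] freud_moment_smult[of "-1" q] by simp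

lemma freud_inner_commute: "freud_inner p q = freud_inner q p"
  by (simp add: freud_inner_moment mult.commute)

lemma freud_inner_lin [simp]:
  "freud_inner (p + q) r = freud_inner p r + freud_inner q r"
  "freud_inner (p - q) r = freud_inner p r - freud_inner q r"
  "freud_inner (smult a p) r = a * freud_inner p r"
  "freud_inner r (p + q) = freud_inner r p + freud_inner r q"
  "freud_inner r (p - q) = freud_inner r p - freud_inner r q"
  "freud_inner r (smult a p) = a * freud_inner r p"
  "freud_inner 0 r = 0" "freud_inner r 0 = 0"
  by (simp_all add: freud_inner_moment algebra_simps freud_moment_add freud_moment_diff freud_moment_smult)
     (simp_all add: freud_moment_def)

lemma freud_inner_pCons_shift: "freud_inner (pCons 0 p) q = freud_inner p (pCons 0 q)"
  by (simp add: freud_inner_moment)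

lemma freud_inner_pderiv:
  "freud_inner (pderiv p) q
     = 4 * freud_inner p (pCons 0 (pCons 0 (pCons 0 q))) - freud_inner p (pderiv q)"
proof -
  have "monom 4 3 * (p * q) = smult 4 (p * pCons 0 (pCons 0 (pCons 0 q)))"
    by (simp add: monom_altdef eval_nat_numeral)
  then have "freud_moment (pderiv (p * q)) = 4 * freud_moment (p * pCons 0 (pCons 0 (pCons 0 q)))"
    by (simp only: freud_moment_pderiv freud_moment_smult)
  then show ?thesis
    by (simp add: pderiv_mult freud_inner_moment freud_moment_add mult.commute[of q])
qed

section \<open>Monic orthogonal polynomials for the Freud weight\<close>

lemma freud_inner_reflect:
  "freud_inner (pcompose p [:0, -1:]) (pcompose q [:0, -1:]) = freud_inner p q"
  by (simp add: freud_inner_moment freud_moment_reflect flip: pcompose_mult)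

lemma pcompose_reflect_reflect: "pcompose (pcompose p [:0, -1:]) [:0, -1:] = (p :: real poly)"
  by (simp add: pcompose_pCons flip: pcompose_assoc)

lemma degree_pcompose_reflect: "degree (pcompose p [:0, -1:]) = degree (p :: real poly)"
  by (simp add: degree_pcompose)

locale freud_ortho =
  fixes P :: "nat \<Rightarrow> real poly"
  assumes P_orth: "\<And>n. monic_orthogonal n (P n)"
begin

lemma degree_P [simp]: "degree (P n) = n"
  and coeff_P_n [simp]: "coeff (P n) n = 1"
  using P_orth[of n] by (auto simp: monic_orthogonal_def monic_of_degree_def)

lemma P_nonzero [simp]: "P n \<noteq> 0"
  using coeff_P_n[of n] by force

lemma P_0: "P 0 = 1"
  using degree_P[of 0] coeff_P_n[of 0] by (metis degree_eq_zeroE coeff_pCons_0 one_pCons)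

definition h :: "nat \<Rightarrow> real" where "h n = freud_inner (P n) (P n)"

lemma h_pos: "0 < h n"
  by (simp add: h_def freud_inner_self_pos)

lemma P_perp: "degree Q < n \<Longrightarrow> freud_inner (P n) Q = 0"
  using P_orth[of n] by (auto simp: monic_orthogonal_def)

lemma inner_P_P: "freud_inner (P m) (P n) = (if m = n then h m else 0)"
proof (cases m n rule: linorder_cases)
  case less then show ?thesis using P_perp[of "P m" n] by (simp add: freud_inner_commute)
next
  case greater then show ?thesis using P_perp[of "P n" m] by simp
qed (simp add: h_def)

lemma inner_P_coeff:
  assumes "degree Q \<le> n"
  shows "freud_inner (P n) Q = coeff Q n * h n"
proof -
  define R where "R = Q - smult (coeff Q n) (P n)"
  have "degree R \<le> n" unfolding R_def using assms by (intro degree_diff_le) auto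
  moreover have "coeff R n = 0" by (simp add: R_def)
  ultimately have "R = 0 \<or> degree R < n"
    by (metis leading_coeff_0_iff nat_less_le)
  then have "freud_inner (P n) R = 0" using P_perp by auto
  then show ?thesis by (simp add: R_def inner_P_P)
qed

text \<open>Pairing \<open>D\<close> with \<open>P (degree D)\<close> isolates its leading
  coefficient. The polynomial identities below are verified by testing the difference of both sides
  against every \<open>P j\<close>.\<close>

lemma eq_0_if_perp:
  assumes "degree D \<le> n" and "\<And>j. j \<le> n \<Longrightarrow> freud_inner (P j) D = 0"
  shows "D = 0"
proof (rule ccontr)
  assume "D \<noteq> 0"
  moreover have "coeff D (degree D) * h (degree D) = 0"
    using assms inner_P_coeff[of D "degree D"] by simp
  ultimately show False using h_pos[of "degree D"] by simp
qed

lemma P_reflect: "pcompose (P n) [:0, -1:] = smult ((-1) ^ n) (P n)"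
proof -
  define D where "D = pcompose (P n) [:0, -1:] - smult ((-1) ^ n) (P n)"
  have "D = 0"
  proof (rule eq_0_if_perp)
    show deg: "degree D \<le> n"
      unfolding D_def by (intro degree_diff_le) (auto simp: degree_pcompose_reflect)
    fix j assume j: "j \<le> n"
    show "freud_inner (P j) D = 0"
    proof (cases "j = n")
      case True
      have "coeff D n = 0" by (simp add: D_def coeff_pcompose_linear)
      then show ?thesis using inner_P_coeff[OF deg] True by simp
    next
      case False
      have "freud_inner (P j) (pcompose (P n) [:0, -1:]) = freud_inner (pcompose (P j) [:0, -1:]) (P n)"
        by (subst freud_inner_reflect[symmetric]) (simp add: pcompose_reflect_reflect)
      also have "\<dots> = 0"
        using False j by (subst freud_inner_commute) (simp add: P_perp degree_pcompose_reflect)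
      finally show ?thesis using False by (simp add: D_def inner_P_P)
    qed
  qed
  then show ?thesis by (simp add: D_def)
qed

text \<open>The convention \<open>c 0 = 0\<close> neutralises the truncated indices in the recurrences below.\<close>

definition c :: "nat \<Rightarrow> real" where "c n = (if n = 0 then 0 else h n / h (n - 1))"

lemma c_0 [simp]: "c 0 = 0" by (simp add: c_def)

lemma c_pos: "0 < n \<Longrightarrow> 0 < c n" by (simp add: c_def h_pos)

lemma c_nonneg: "0 \<le> c n" by (simp add: c_def h_pos less_imp_le)

lemma h_Suc: "h (Suc n) = c (Suc n) * h n"
  using h_pos[of n] by (simp add: c_def)

lemma inner_P_shift_self: "freud_inner (P n) (pCons 0 (P n)) = 0"
proof -
  have "freud_inner (P n) (pCons 0 (P n))
      = freud_inner (pcompose (P n) [:0, -1:]) (pcompose (pCons 0 (P n)) [:0, -1:])"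
    by (simp only: freud_inner_reflect)
  also have "pcompose (pCons 0 (P n)) [:0, -1:] = smult (- ((-1) ^ n)) (pCons 0 (P n))"
    by (simp add: pcompose_pCons P_reflect)
  also have "freud_inner (pcompose (P n) [:0, -1:]) \<dots>
      = - ((-1) ^ n * (-1) ^ n) * freud_inner (P n) (pCons 0 (P n))"
    by (simp only: P_reflect freud_inner_lin) simp
  also have "(-1) ^ n * (-1) ^ n = (1::real)" by (simp flip: power_mult_distrib)
  finally show ?thesis by simp
qed

text \<open>There is no term in \<open>P n\<close> because the pairing of \<open>P n\<close> with
  \<open>x P n\<close> vanishes by parity; the indices below \<open>n - 1\<close> drop out on moving
  \<open>x\<close> to the other factor.\<close>

lemma P_rec: "pCons 0 (P n) = P (Suc n) + smult (c n) (P (n - 1))"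
proof -
  define D where "D = pCons 0 (P n) - (P (Suc n) + smult (c n) (P (n - 1)))"
  have "D = 0"
  proof (rule eq_0_if_perp)
    show "degree D \<le> Suc n"
      unfolding D_def by (intro degree_diff_le degree_add_le) auto
    fix j assume j: "j \<le> Suc n"
    have x: "freud_inner (P j) (pCons 0 (P n)) = freud_inner (P n) (pCons 0 (P j))"
      by (metis freud_inner_commute freud_inner_pCons_shift)
    consider "j = Suc n" | "j = n" | "Suc j = n" | "Suc j < n" using j by linarith
    then show "freud_inner (P j) D = 0"
    proof cases
      case 1
      then show ?thesis by (simp add: D_def inner_P_P inner_P_coeff)
    next
      case 2
      then show ?thesis by (cases n) (simp_all add: D_def inner_P_P inner_P_shift_self)
    next
      case 3
      then show ?thesis unfolding D_def freud_inner_lin x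
        by (auto simp: inner_P_P inner_P_coeff h_Suc)
    next
      case 4
      then show ?thesis unfolding D_def freud_inner_lin x
        by (auto simp: inner_P_P P_perp)
    qed
  qed
  then show ?thesis by (simp add: D_def)
qed

section \<open>String equation and derivatives of the orthogonal polynomials\<close>

definition d :: "nat \<Rightarrow> real" where "d n = 4 * c n * c (n - 1) * c (n - 2)"

lemma pCons_0_add: "pCons 0 (p + q) = pCons 0 p + pCons (0::real) q"
  and pCons_0_smult: "pCons 0 (smult a p) = smult a (pCons (0::real) p)"
  by simp_all

text \<open>Integration by parts against \<open>exp (- (x ^ 4))\<close> produces the factor
  \<open>x^3\<close>, hence three applications of the recurrence.\<close>

lemma P_rec_cube:
  "pCons 0 (pCons 0 (pCons 0 (P n))) =
     P (n + 3) + smult (c (n + 2) + c (n + 1) + c n) (P (n + 1))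
     + (smult (c n * (c (n + 1) + c n + c (n - 1))) (P (n - 1))
     + smult (c n * c (n - 1) * c (n - 2)) (P (n - 3)))"
proof -
  note expand = P_rec pCons_0_add pCons_0_smult smult_add_left smult_add_right
    numeral_2_eq_2 numeral_3_eq_3 algebra_simps
  show ?thesis
  proof (cases n)
    case 0
    then show ?thesis by (simp add: expand del: add_pCons smult_pCons)
  next
    case (Suc m)
    then show ?thesis by (cases m) (simp_all add: expand del: add_pCons smult_pCons)
  qed
qed

lemma inner_pderiv_P:
  assumes "j < n"
  shows "freud_inner (P j) (pderiv (P n)) = 4 * freud_inner (P n) (pCons 0 (pCons 0 (pCons 0 (P j))))"
proof -
  have "degree (pderiv (P j)) < n" using assms by (simp add: degree_pderiv)
  then have "freud_inner (P n) (pderiv (P j)) = 0" by (rule P_perp)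
  then show ?thesis
    by (subst freud_inner_commute) (simp only: freud_inner_pderiv)
qed

lemma inner_pderiv_P_pred: "freud_inner (P n) (pderiv (P (Suc n))) = real (Suc n) * h n"
  by (subst inner_P_coeff) (auto simp: degree_pderiv coeff_pderiv)

lemma neq_diff: "Suc m \<noteq> m - k" "Suc (Suc m) \<noteq> m - k" for m k :: nat
  by linarith+

text \<open>The pairing of \<open>P (n - 1)\<close> with the derivative of \<open>P n\<close> is
  evaluated twice: from the leading coefficient, and by parts as four times the pairing of
  \<open>P n\<close> with \<open>x^3 P (n - 1)\<close>.\<close>

lemma c_string: "4 * c n * (c (n + 1) + c n + c (n - 1)) = real n"
proof (cases n)
  case (Suc m)
  have "real (Suc m) * h m = 4 * (h (Suc m) * (c (m + 2) + c (m + 1) + c m))"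
    unfolding inner_pderiv_P_pred[symmetric]
    by (subst inner_pderiv_P) (simp_all add: P_rec_cube inner_P_P neq_diff)
  then have "real (Suc m) * h m = (4 * c (Suc m) * (c (m + 2) + c (m + 1) + c m)) * h m"
    by (simp add: h_Suc mult_ac)
  then have "real (Suc m) = 4 * c (Suc m) * (c (m + 2) + c (m + 1) + c m)"
    using h_pos[of m] by (metis less_irrefl mult_right_cancel)
  then show ?thesis using Suc by simp
qed simp

text \<open>By parts, pairing the derivative with \<open>P j\<close> amounts to pairing
  \<open>P n\<close> with \<open>x^3 P j\<close>. So the indices below \<open>n - 3\<close> drop out
  by degree, and \<open>n - 2\<close> drops out by parity.\<close>

lemma pderiv_P: "pderiv (P n) = smult (real n) (P (n - 1)) + smult (d n) (P (n - 3))"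
proof (cases "n = 0")
  case True then show ?thesis by (simp add: P_0 d_def)
next
  case False
  define D where "D = pderiv (P n) - (smult (real n) (P (n - 1)) + smult (d n) (P (n - 3)))"
  have "D = 0"
  proof (rule eq_0_if_perp)
    show "degree D \<le> n - 1"
      unfolding D_def by (intro degree_diff_le degree_add_le) (auto simp: degree_pderiv)
    fix j assume j: "j \<le> n - 1"
    consider "n = Suc j" | "n = j + 2" | "n = (n - 3) + 3" "j \<le> n - 3"
      using j False by linarith
    then show "freud_inner (P j) D = 0"
    proof cases
      case 1
      \<comment> \<open>Truncated subtraction makes \<open>n - 3\<close> coincide with
        \<open>j\<close> when \<open>j = 0\<close>; then \<open>d n\<close> vanishes through a
        factor \<open>c 0\<close>.\<close>
      have "d (Suc j) = 0 \<or> j \<noteq> Suc j - 3" by (cases j) (auto simp: d_def)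
      then show ?thesis using 1
        by (auto simp: D_def inner_pderiv_P_pred inner_P_P)
    next
      case 2
      have "d n = 0 \<or> j \<noteq> n - 3" using 2 by (cases j) (auto simp: d_def)
      moreover have "freud_inner (P j) (pderiv (P n)) = 0"
        using 2 by (subst inner_pderiv_P) (simp_all add: P_rec_cube inner_P_P neq_diff)
      ultimately show ?thesis using 2 by (auto simp: D_def inner_P_P)
    next
      case 3
      then obtain m where n: "n = m + 3" and jm: "j \<le> m" by blast
      have "h n = c (m + 3) * c (m + 2) * c (m + 1) * h m"
        unfolding n by (simp add: numeral_2_eq_2 numeral_3_eq_3 h_Suc)
      then show ?thesis using n jm
        unfolding D_def freud_inner_lin
        by (subst inner_pderiv_P) (auto simp: P_rec_cube inner_P_P d_def)
    qed
  qed
  then show ?thesis by (simp add: D_def)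
qed

end

section \<open>Sobolev orthogonal polynomials\<close>

lemma pderiv_reflect: "pderiv (pcompose p [:0, -1:]) = smult (-1) (pcompose (pderiv p) [:0, -1:])"
  for p :: "real poly"
  by (simp add: pderiv_pcompose pderiv_pCons)

lemma sobolev_inner_reflect:
  "sobolev_inner l (pcompose p [:0, -1:]) (pcompose q [:0, -1:]) = sobolev_inner l p q"
  by (simp only: sobolev_inner_def pderiv_reflect freud_inner_lin freud_inner_reflect)

lemma sobolev_inner_commute: "sobolev_inner l p q = sobolev_inner l q p"
  by (simp add: sobolev_inner_def freud_inner_commute)

lemma sobolev_inner_lin [simp]:
  "sobolev_inner l (p + q) r = sobolev_inner l p r + sobolev_inner l q r"
  "sobolev_inner l (p - q) r = sobolev_inner l p r - sobolev_inner l q r"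
  "sobolev_inner l (smult a p) r = a * sobolev_inner l p r"
  "sobolev_inner l r (p + q) = sobolev_inner l r p + sobolev_inner l r q"
  "sobolev_inner l r (p - q) = sobolev_inner l r p - sobolev_inner l r q"
  "sobolev_inner l r (smult a p) = a * sobolev_inner l r p"
  "sobolev_inner l 0 r = 0" "sobolev_inner l r 0 = 0"
  by (simp_all add: sobolev_inner_def pderiv_add pderiv_diff pderiv_smult algebra_simps)

lemma freud_inner_le_sobolev_inner:
  assumes "0 \<le> l"
  shows "freud_inner p p \<le> sobolev_inner l p p"
  using assms by (simp add: sobolev_inner_def freud_inner_self_nonneg)

context freud_ortho
begin

text \<open>For \<open>n > 0\<close> this is the quotient of
  \<open>(d n)\<^sup>2 * h (n - 3)\<close> by \<open>n\<^sup>2 * h (n - 1)\<close>, the two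
  contributions to the squared norm of the derivative of \<open>P n\<close>.\<close>

definition beta :: "nat \<Rightarrow> real" where
  "beta n = 16 * (c n)\<^sup>2 * c (n - 1) * c (n - 2) / (real n)\<^sup>2"

lemma beta_nonneg: "0 \<le> beta n"
  by (simp add: beta_def c_nonneg)

text \<open>The quantity \<open>tau l n\<close> is \<open>l n\<^sup>2 h\<^bsub>n-1\<^esub>\<close> divided by the squared Sobolev norm of \<open>T l n\<close>.
  Unlike its reciprocal, it is bounded uniformly in \<open>l\<close>.\<close>

fun tau :: "real \<Rightarrow> nat \<Rightarrow> real" where
  "tau l 0 = 0"
| "tau l (Suc n) =
     1 / (1 + beta (Suc n) * (1 - tau l (n - 1)) + c (Suc n) / (l * (real (Suc n))\<^sup>2))"

text \<open>A Gram-Schmidt step: the coefficient is the pairing of \<open>P (n + 2)\<close> with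
  \<open>P n\<close> over the squared norm of \<open>T l n\<close>, which \<open>tau\<close>
  encodes. At \<open>n = 0\<close> the division by zero gives 0, in accordance with
  \<open>d 2 = 0\<close>.\<close>

fun T :: "real \<Rightarrow> nat \<Rightarrow> real poly" where
  "T l 0 = P 0"
| "T l (Suc 0) = P (Suc 0)"
| "T l (Suc (Suc n)) = P (Suc (Suc n)) - smult (d (n + 2) * tau l n / real n) (T l n)"

lemma tau_bounds:
  assumes "0 < l"
  shows "0 \<le> tau l n \<and> tau l n \<le> 1"
  using assms
proof (induction l n rule: tau.induct)
  case (2 l n)
  then have "0 \<le> beta (Suc n) * (1 - tau l (n - 1))" "0 \<le> c (Suc n) / (l * (real (Suc n))\<^sup>2)"
    by (auto simp: beta_nonneg c_nonneg)
  then show ?case by (simp add: field_simps del: of_nat_Suc)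
qed simp

lemma degree_coeff_T: "degree (T l n) = n \<and> coeff (T l n) n = 1"
proof (induction l n rule: T.induct)
  case (3 l n)
  have "degree (T l (Suc (Suc n))) \<le> Suc (Suc n)"
    using 3 by (auto intro!: degree_diff_le order.trans[OF degree_smult_le])
  moreover have "coeff (T l (Suc (Suc n))) (Suc (Suc n)) = 1"
    using 3 by (simp add: coeff_eq_0)
  ultimately show ?case by (metis le_antisym le_degree zero_neq_one)
qed auto

lemma degree_T [simp]: "degree (T l n) = n" and coeff_T [simp]: "coeff (T l n) n = 1"
  using degree_coeff_T by auto

lemma T_reflect: "pcompose (T l n) [:0, -1:] = smult ((-1) ^ n) (T l n)"
  by (induction l n rule: T.induct)
     (simp_all add: P_reflect pcompose_diff pcompose_smult smult_diff_right mult.commute)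

lemma sobolev_T_P_parity:
  assumes "odd (m + n)"
  shows "sobolev_inner l (T l m) (P n) = 0"
proof -
  have "sobolev_inner l (T l m) (P n) = (-1) ^ (m + n) * sobolev_inner l (T l m) (P n)"
    by (subst sobolev_inner_reflect[symmetric]) (simp add: T_reflect P_reflect power_add)
  with assms show ?thesis by simp
qed

text \<open>The derivative of \<open>P (n + 2)\<close> is a combination of \<open>P (n + 1)\<close>
  and \<open>P (n - 1)\<close>, both orthogonal to the derivative of \<open>Q\<close>. With parity,
  this leaves only the couplings of \<open>P n\<close> and \<open>P (n + 2)\<close> off the
  diagonal.\<close>

lemma sobolev_P_perp:
  assumes "degree Q < n"
  shows "sobolev_inner l (P (n + 2)) Q = 0"
proof -
  have "freud_inner (P (n - 1)) (pderiv Q) = 0"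
  proof (cases "degree Q = 0")
    case True
    then have "pderiv Q = 0" by (simp add: pderiv_eq_0_iff)
    then show ?thesis by simp
  next
    case False then show ?thesis using assms by (intro P_perp) (simp add: degree_pderiv)
  qed
  moreover have "freud_inner (P (Suc n)) (pderiv Q) = 0" "freud_inner (P (n + 2)) Q = 0"
    using assms by (auto intro!: P_perp simp: degree_pderiv)
  ultimately show ?thesis by (simp add: sobolev_inner_def pderiv_P)
qed

lemma sobolev_P_P_diag:
  "sobolev_inner l (P n) (P n) = h n + l * ((real n)\<^sup>2 * h (n - 1) + (d n)\<^sup>2 * h (n - 3))"
proof -
  have "d n = 0 \<or> n - 1 \<noteq> n - 3"
    by (cases "n \<le> 2") (auto simp: d_def numeral_2_eq_2 le_Suc_eq)
  then show ?thesis
    by (auto simp: sobolev_inner_def h_def[symmetric] pderiv_P inner_P_P power2_eq_square)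
qed

lemma sobolev_P_P_offdiag:
  "sobolev_inner l (P (n + 2)) (P n) = l * d (n + 2) * real n * h (n - 1)"
proof -
  have "d n = 0 \<or> n - 1 \<noteq> n - 3"
    by (cases "n \<le> 2") (auto simp: d_def numeral_2_eq_2 le_Suc_eq)
  then show ?thesis
    by (auto simp: sobolev_inner_def pderiv_P inner_P_P neq_diff)
qed

lemma d_2 [simp]: "d (Suc (Suc 0)) = 0" by (simp add: d_def)

text \<open>The second claim identifies \<open>tau\<close> as a normalised inverse squared norm,
  which is what makes the Gram-Schmidt coefficient cancel in the induction step. Stated as a
  product, it also covers \<open>n = 0\<close>.\<close>

lemma sobolev_T_P:
  assumes l: "0 < l"
  shows "(\<forall>j<n. sobolev_inner l (T l n) (P j) = 0)
       \<and> sobolev_inner l (T l n) (P n) * tau l n = l * (real n)\<^sup>2 * h (n - 1)"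
  using l
proof (induction l n rule: T.induct)
  case (1 l)
  then show ?case by simp
next
  case (2 l)
  have "sobolev_inner l (P 1) (P 1) = (1 + c 1 / l) * (l * h 0)"
    using 2 h_pos[of 0] by (simp add: sobolev_P_P_diag d_def h_Suc field_simps)
  moreover have "0 < 1 + c 1 / l" using 2 c_pos[of 1] by (simp add: add_pos_pos)
  ultimately show ?case
    using sobolev_T_P_parity[of 1 0 l] by (simp add: beta_def)
next
  case (3 l n)
  define k where "k = sobolev_inner l (T l n) (P n)"
  have IH: "\<And>j. j < n \<Longrightarrow> sobolev_inner l (T l n) (P j) = 0"
    and k: "k * tau l n = l * (real n)\<^sup>2 * h (n - 1)"
    using 3 by (auto simp: k_def)
  let ?a = "d (n + 2) * tau l n / real n"
  have "sobolev_inner l (T l (Suc (Suc n))) (P j) = 0" if j: "j < n + 2" for j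
  proof -
    \<comment> \<open>These cases are settled by bandedness, by the choice of the coefficient, and
      by parity, respectively.\<close>
    consider "j < n" | "j = n" | "j = n + 1" using j by linarith
    then show ?thesis
    proof cases
      case 1
      then have "sobolev_inner l (P (n + 2)) (P j) = 0" by (intro sobolev_P_perp) simp
      then show ?thesis using IH 1 by simp
    next
      case 2
      have "?a * k = l * d (n + 2) * real n * h (n - 1)"
      proof (cases "n = 0")
        case False
        have "?a * k = d (n + 2) / real n * (k * tau l n)" by simp
        also have "\<dots> = l * d (n + 2) * real n * h (n - 1)"
          unfolding k using False by (simp add: power2_eq_square)
        finally show ?thesis .
      qed simp
      then show ?thesis using 2 sobolev_P_P_offdiag[of l n] by (simp add: k_def)
    next
      case 3
      then show ?thesis by (intro sobolev_T_P_parity) simp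
    qed
  qed
  moreover have "sobolev_inner l (T l (Suc (Suc n))) (P (Suc (Suc n))) * tau l (Suc (Suc n))
      = l * (real (Suc (Suc n)))\<^sup>2 * h (Suc n)"
  proof -
    \<comment> \<open>\<open>P (n + 2)\<close> sees only the leading part of \<open>T l n\<close>,
      since \<open>T l n - P n\<close> has degree below \<open>n\<close> or is zero.\<close>
    have TP: "sobolev_inner l (T l n) (P (n + 2)) = l * d (n + 2) * real n * h (n - 1)"
    proof -
      have "T l n = P n \<or> degree (T l n - P n) < n"
        by (metis coeff_P_n coeff_T coeff_diff degree_P degree_T degree_diff_le diff_self eq_iff_diff_eq_0 leading_coeff_0_iff nat_less_le order_refl)
      then have "sobolev_inner l (P (n + 2)) (T l n - P n) = 0"
        using sobolev_P_perp[of "T l n - P n" n l] by auto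
      then show ?thesis
        using sobolev_P_P_offdiag[of l n] sobolev_inner_commute[of l "T l n" "P (n + 2)"] by simp
    qed
    define q where "q = 1 + beta (n + 2) * (1 - tau l n) + c (n + 2) / (l * (real (n + 2))\<^sup>2)"
    have q: "0 < q"
      unfolding q_def using tau_bounds[of l n] 3(2) beta_nonneg[of "n+2"] c_nonneg[of "n+2"]
      by (intro add_pos_nonneg) auto
    have dd: "(d (n + 2))\<^sup>2 * h (n - 1) = beta (n + 2) * (real (n + 2))\<^sup>2 * h (n + 1)"
    proof (cases n)
      case (Suc m)
      have "h (n + 1) = c (n + 1) * c n * h m" using Suc by (simp add: h_Suc)
      then show ?thesis using Suc by (simp add: d_def beta_def power2_eq_square)
    qed (simp add: beta_def)
    have "?a * (l * d (n + 2) * real n * h (n - 1)) = tau l n * l * ((d (n + 2))\<^sup>2 * h (n - 1))"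
      by (cases "n = 0") (simp_all add: power2_eq_square)
    then have "sobolev_inner l (T l (Suc (Suc n))) (P (Suc (Suc n)))
        = h (n + 2) + l * ((real (n + 2))\<^sup>2 * h (n + 1) + (d (n + 2))\<^sup>2 * h (n - 1))
          - tau l n * l * ((d (n + 2))\<^sup>2 * h (n - 1))"
      using TP sobolev_P_P_diag[of l "n + 2"] by simp
    also have "\<dots> = q * (l * (real (n + 2))\<^sup>2 * h (n + 1))"
      unfolding dd q_def using 3(2) by (simp add: h_Suc field_simps del: of_nat_Suc of_nat_add)
    finally show ?thesis
      using q by (simp add: q_def)
  qed
  ultimately show ?case by simp
qed

lemma sobolev_T_perp:
  assumes l: "0 < l" and "degree Q < n"
  shows "sobolev_inner l (T l n) Q = 0"
  using assms(2)
proof (induction "degree Q" arbitrary: Q rule: less_induct)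
  case less
  define R where "R = Q - smult (coeff Q (degree Q)) (P (degree Q))"
  have "degree R \<le> degree Q" unfolding R_def by (intro degree_diff_le) auto
  moreover have "coeff R (degree Q) = 0" by (simp add: R_def)
  ultimately have "R = 0 \<or> degree R < degree Q"
    by (metis leading_coeff_0_iff nat_less_le)
  then have "sobolev_inner l (T l n) R = 0" using less by auto
  moreover have "sobolev_inner l (T l n) (P (degree Q)) = 0"
    using sobolev_T_P[OF l] less.prems by blast
  ultimately show ?case by (simp add: R_def)
qed

text \<open>Pythagoras: \<open>S\<close> differs from \<open>T l n\<close> by a polynomial
  \<open>R\<close> orthogonal to \<open>T l n\<close>, so minimality forces the norm of
  \<open>R\<close> to vanish.\<close>

lemma sobolev_minimizer_eq_T:
  assumes l: "0 < l" and S: "sobolev_minimizer l n S"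
  shows "S = T l n"
proof -
  define R where "R = S - T l n"
  have "degree R \<le> n" "coeff R n = 0"
    using S unfolding R_def sobolev_minimizer_def monic_of_degree_def
    by (auto intro!: degree_diff_le)
  then have "R = 0 \<or> degree R < n" by (metis leading_coeff_0_iff nat_less_le)
  then have "sobolev_inner l (T l n) R = 0" using sobolev_T_perp[OF l] by auto
  moreover have "S = T l n + R" by (simp add: R_def)
  ultimately have "sobolev_inner l S S = sobolev_inner l (T l n) (T l n) + sobolev_inner l R R"
    using sobolev_inner_commute[of l R "T l n"] by simp
  moreover have "monic_of_degree n (T l n)" by (simp add: monic_of_degree_def)
  ultimately have "sobolev_inner l R R \<le> 0"
    using S by (auto simp: sobolev_minimizer_def)
  then have "R = 0"
    using freud_inner_le_sobolev_inner[of l R] freud_inner_self_pos[of R] l by force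
  then show ?thesis by (simp add: R_def)
qed

end

section \<open>Asymptotics of the recurrence coefficients\<close>

lemma sqrt_diff_ratio_tendsto: "(\<lambda>n. sqrt (real (n - k)) / sqrt (real n)) \<longlonglongrightarrow> 1"
proof -
  have "(\<lambda>n. sqrt (real n - real k) / sqrt (real n)) \<longlonglongrightarrow> 1" by real_asymp
  then show ?thesis
    by (rule Lim_transform_eventually)
       (auto intro!: eventually_mono[OF eventually_ge_at_top[of k]] simp: of_nat_diff)
qed

text \<open>Freud's argument: along subsequences realising the upper limit \<open>s\<close> and the lower limit \<open>i\<close>
  of \<open>c n / sqrt n\<close>, the string equation gives \<open>s (s + 2 i) \<le> 1/4 \<le> i (i + 2 s)\<close>, hence \<open>s = i\<close>.\<close>

lemma string_equation_limit:
  fixes c :: "nat \<Rightarrow> real"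
  assumes nonneg: "\<And>n. 0 \<le> c n" and c0: "c 0 = 0"
    and string: "\<And>n. 4 * c n * (c (n + 1) + c n + c (n - 1)) = real n"
  shows "(\<lambda>n. c n / sqrt (real n)) \<longlonglongrightarrow> 1 / sqrt 12"
proof -
  define x where "x n = c n / sqrt (real n)" for n
  \<comment> \<open>\<open>A\<close> and \<open>B\<close> compensate for normalising the neighbours
    of \<open>c n\<close> by their own indices instead of \<open>n\<close>.\<close>
  define A where "A n = sqrt (real (n + 1)) / sqrt (real n)" for n
  define B where "B n = sqrt (real (n - 1)) / sqrt (real n)" for n
  have x0: "0 \<le> x n" for n by (simp add: x_def nonneg)
  have A0: "0 \<le> A n" and B0: "0 \<le> B n" for n by (simp_all add: A_def B_def)
  have eq: "x n * (x n + (A n * x (n + 1) + B n * x (n - 1))) = 1 / 4" if "0 < n" for n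
  proof -
    have "A n * x (n + 1) = c (n + 1) / sqrt (real n)"
      by (simp add: A_def x_def del: of_nat_Suc)
    moreover have "B n * x (n - 1) = c (n - 1) / sqrt (real n)"
      using c0 by (cases "n = 1") (simp_all add: B_def x_def del: of_nat_diff)
    ultimately have "x n * (x n + (A n * x (n + 1) + B n * x (n - 1)))
        = c n * (c (n + 1) + c n + c (n - 1)) / (sqrt (real n) * sqrt (real n))"
      by (simp add: x_def add_divide_distrib[symmetric] algebra_simps)
    also have "\<dots> = (real n / 4) / real n" using string[of n] by simp
    finally show ?thesis using that by simp
  qed
  have x1: "x n \<le> 1 / 2" for n
  proof (cases "n = 0")
    case False
    \<comment> \<open>Dropping the nonnegative neighbours from the normalised string equation leaves
      an upper bound for the square.\<close>
    have "x n * x n \<le> x n * (x n + (A n * x (n + 1) + B n * x (n - 1)))"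
      using x0 A0 B0 by (intro mult_left_mono) auto
    also have "\<dots> = (1 / 2) * (1 / 2)" using eq False by simp
    finally show ?thesis
      by (metis abs_le_square_iff abs_of_nonneg power2_eq_square x0 zero_le_divide_1_iff zero_le_numeral)
  qed (simp add: x_def c0)
  define u where "u k = (SUP n\<in>{k..}. x n)" for k
  define v where "v k = (INF n\<in>{k..}. x n)" for k
  have bdd: "bdd_above (x ` {k..})" "bdd_below (x ` {k..})" for k
    using x0 x1 by (auto intro!: bdd_aboveI2[where M = "1 / 2"] bdd_belowI2[where m = 0])
  have xu: "x n \<le> u k" and vx: "v k \<le> x n" if "k \<le> n" for n k
    using that bdd by (auto simp: u_def v_def intro!: cSUP_upper cINF_lower)
  have "decseq u" unfolding u_def
    by (intro decseq_SucI cSUP_subset_mono) (auto intro: bdd)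
  moreover have "incseq v" unfolding v_def
    by (intro incseq_SucI cINF_superset_mono) (auto intro: bdd)
  moreover have uv: "0 \<le> u k" "0 \<le> v k" "u k \<le> 1 / 2" "v k \<le> 1 / 2" for k
  proof -
    show "0 \<le> u k" "v k \<le> 1 / 2"
      by (rule order.trans[OF x0 xu[of k k]] order.trans[OF vx[of k k] x1], simp)+
    show "0 \<le> v k" unfolding v_def by (rule cINF_greatest) (simp_all add: x0)
    show "u k \<le> 1 / 2" unfolding u_def by (rule cSUP_least) (use x1 in simp_all)
  qed
  ultimately obtain s i where s: "u \<longlonglongrightarrow> s" and i: "v \<longlonglongrightarrow> i"
    by (metis decseq_convergent incseq_convergent)
  have i0: "0 \<le> i" using i uv by (intro LIMSEQ_le_const) auto
  have s0: "0 \<le> s" using s uv by (intro LIMSEQ_le_const) auto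
  \<comment> \<open>Starting at \<open>Suc k\<close> keeps the chosen index positive and both its
    neighbours at least \<open>k\<close>, where \<open>u k\<close> and \<open>v k\<close> bound
    them.\<close>
  have "\<exists>n\<ge>Suc k. u (Suc k) - 1 / real (Suc k) < x n" for k
  proof -
    have "u (Suc k) - 1 / real (Suc k) < (SUP n\<in>{Suc k..}. x n)" by (simp add: u_def)
    then show ?thesis by (subst (asm) less_cSUP_iff) (auto intro: bdd)
  qed
  then obtain r where r: "\<And>k. Suc k \<le> r k" "\<And>k. u (Suc k) - 1 / real (Suc k) < x (r k)" by metis
  have "\<exists>n\<ge>Suc k. x n < v (Suc k) + 1 / real (Suc k)" for k
  proof -
    have "(INF n\<in>{Suc k..}. x n) < v (Suc k) + 1 / real (Suc k)" by (simp add: v_def)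
    then show ?thesis by (subst (asm) cINF_less_iff) (auto intro: bdd)
  qed
  then obtain r' where r': "\<And>k. Suc k \<le> r' k" "\<And>k. x (r' k) < v (Suc k) + 1 / real (Suc k)" by metis
  have inv0: "(\<lambda>k. 1 / real (Suc k)) \<longlonglongrightarrow> 0" by real_asymp
  have xr: "(\<lambda>k. x (r k)) \<longlonglongrightarrow> s"
  proof (rule tendsto_sandwich)
    show "\<forall>\<^sub>F k in sequentially. u (Suc k) - 1 / real (Suc k) \<le> x (r k)"
      using r(2) by (simp add: less_imp_le)
    show "\<forall>\<^sub>F k in sequentially. x (r k) \<le> u (Suc k)" using r(1) xu by simp
    show "(\<lambda>k. u (Suc k) - 1 / real (Suc k)) \<longlonglongrightarrow> s"
      using tendsto_diff[OF LIMSEQ_Suc[OF s] inv0] by simp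
    show "(\<lambda>k. u (Suc k)) \<longlonglongrightarrow> s" by (rule LIMSEQ_Suc[OF s])
  qed
  have xr': "(\<lambda>k. x (r' k)) \<longlonglongrightarrow> i"
  proof (rule tendsto_sandwich)
    show "\<forall>\<^sub>F k in sequentially. x (r' k) \<le> v (Suc k) + 1 / real (Suc k)"
      using r'(2) by (simp add: less_imp_le)
    show "\<forall>\<^sub>F k in sequentially. v (Suc k) \<le> x (r' k)" using r'(1) vx by simp
    show "(\<lambda>k. v (Suc k) + 1 / real (Suc k)) \<longlonglongrightarrow> i"
      using tendsto_add[OF LIMSEQ_Suc[OF i] inv0] by simp
    show "(\<lambda>k. v (Suc k)) \<longlonglongrightarrow> i" by (rule LIMSEQ_Suc[OF i])
  qed
  have AB: "(\<lambda>n. A n + B n) \<longlonglongrightarrow> 2"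
  proof -
    have "A \<longlonglongrightarrow> 1" unfolding A_def by real_asymp
    from tendsto_add[OF this sqrt_diff_ratio_tendsto[of 1]] show ?thesis by (simp add: B_def)
  qed
  have r_top: "filterlim r sequentially sequentially" "filterlim r' sequentially sequentially"
    using r(1) r'(1)
    by (auto intro!: filterlim_at_top_mono[OF filterlim_Suc])
  have "s * (s + 2 * i) \<le> 1 / 4"
  proof (rule LIMSEQ_le_const2)
    show "(\<lambda>k. x (r k) * (x (r k) + (A (r k) + B (r k)) * v k)) \<longlonglongrightarrow> s * (s + 2 * i)"
      by (intro tendsto_intros xr i filterlim_compose[OF AB r_top(1)])
    have "x (r k) * (x (r k) + (A (r k) + B (r k)) * v k) \<le> 1 / 4" for k
    proof -
      have "v k \<le> x (r k + 1)" "v k \<le> x (r k - 1)" "0 < r k" using r(1)[of k] by (auto intro!: vx)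
      then have "x (r k) * (x (r k) + (A (r k) + B (r k)) * v k)
          \<le> x (r k) * (x (r k) + (A (r k) * x (r k + 1) + B (r k) * x (r k - 1)))"
        unfolding distrib_right using x0 A0 B0 by (intro mult_left_mono add_mono) auto
      with eq[of "r k"] \<open>0 < r k\<close> show ?thesis by simp
    qed
    then show "\<exists>N. \<forall>k\<ge>N. x (r k) * (x (r k) + (A (r k) + B (r k)) * v k) \<le> 1 / 4" by blast
  qed
  moreover have "1 / 4 \<le> i * (i + 2 * s)"
  proof (rule LIMSEQ_le_const)
    show "(\<lambda>k. x (r' k) * (x (r' k) + (A (r' k) + B (r' k)) * u k)) \<longlonglongrightarrow> i * (i + 2 * s)"
      by (intro tendsto_intros xr' s filterlim_compose[OF AB r_top(2)])
    have "1 / 4 \<le> x (r' k) * (x (r' k) + (A (r' k) + B (r' k)) * u k)" for k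
    proof -
      have "x (r' k + 1) \<le> u k" "x (r' k - 1) \<le> u k" "0 < r' k" using r'(1)[of k] by (auto intro!: xu)
      then have "x (r' k) * (x (r' k) + (A (r' k) * x (r' k + 1) + B (r' k) * x (r' k - 1)))
          \<le> x (r' k) * (x (r' k) + (A (r' k) + B (r' k)) * u k)"
        unfolding distrib_right using x0 A0 B0 by (intro mult_left_mono add_mono) auto
      with eq[of "r' k"] \<open>0 < r' k\<close> show ?thesis by simp
    qed
    then show "\<exists>N. \<forall>k\<ge>N. 1 / 4 \<le> x (r' k) * (x (r' k) + (A (r' k) + B (r' k)) * u k)" by blast
  qed
  \<comment> \<open>The mixed product \<open>2 * s * i\<close> cancels between the two
    inequalities.\<close>
  ultimately have "s * s \<le> i * i" and lim: "s * (s + 2 * i) \<le> 1 / 4" "1 / 4 \<le> i * (i + 2 * s)"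
    by (auto simp: algebra_simps)
  then have "s \<le> i" using i0 by (metis power2_eq_square power2_le_imp_le)
  moreover have "v k \<le> u k" for k using vx[of k k] xu[of k k] by simp
  then have "i \<le> s" by (intro LIMSEQ_le[OF i s]) simp
  ultimately have si: "s = i" by simp
  with lim have "i\<^sup>2 = 1 / 12" by (simp add: power2_eq_square)
  then have "i = 1 / sqrt 12" using i0 by (metis real_sqrt_divide real_sqrt_one real_sqrt_unique)
  moreover have "x \<longlonglongrightarrow> i"
    by (rule tendsto_sandwich[OF _ _ i s[unfolded si]]) (simp_all add: xu vx)
  ultimately show ?thesis by (simp add: x_def[abs_def])
qed

context freud_ortho
begin

lemma c_shift_limit: "(\<lambda>n. c (n - k) / sqrt (real n)) \<longlonglongrightarrow> 1 / sqrt 12"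
proof -
  have "(\<lambda>n. c (n - k) / sqrt (real (n - k))) \<longlonglongrightarrow> 1 / sqrt 12"
    by (rule filterlim_compose[OF string_equation_limit filterlim_minus_const_nat_at_top])
       (use c_string c_nonneg in auto)
  from tendsto_mult[OF this sqrt_diff_ratio_tendsto[of k]]
  have "(\<lambda>n. c (n - k) / sqrt (real (n - k)) * (sqrt (real (n - k)) / sqrt (real n))) \<longlonglongrightarrow> 1 / sqrt 12"
    by simp
  then show ?thesis
    by (rule Lim_transform_eventually)
       (auto intro!: eventually_mono[OF eventually_gt_at_top[of k]])
qed

lemma c_limit: "(\<lambda>n. c n / sqrt (real n)) \<longlonglongrightarrow> 1 / sqrt 12"
  using c_shift_limit[of 0] by simp

lemma c_at_top: "filterlim c at_top sequentially"
proof -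
  have "filterlim (\<lambda>n. c n / sqrt (real n) * sqrt (real n)) at_top sequentially"
    by (rule filterlim_tendsto_pos_mult_at_top[OF c_limit]) (simp, real_asymp)
  then show ?thesis
    by (rule filterlim_cong[THEN iffD1, rotated -1])
       (auto intro!: eventually_mono[OF eventually_gt_at_top[of 0]])
qed

lemma c_ratio_limit: "(\<lambda>n. c n / c (n - 1)) \<longlonglongrightarrow> 1"
proof -
  have "(\<lambda>n. (c n / sqrt (real n)) / (c (n - 1) / sqrt (real n))) \<longlonglongrightarrow> (1 / sqrt 12) / (1 / sqrt 12)"
    by (intro tendsto_divide c_limit c_shift_limit) simp
  then have "(\<lambda>n. (c n / sqrt (real n)) / (c (n - 1) / sqrt (real n))) \<longlonglongrightarrow> 1" by simp
  then show ?thesis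
    by (rule Lim_transform_eventually)
       (auto intro!: eventually_mono[OF eventually_gt_at_top[of 0]])
qed

lemma beta_limit: "beta \<longlonglongrightarrow> 1 / 9"
proof -
  let ?q = "\<lambda>k n. c (n - k) / sqrt (real n)"
  have "(\<lambda>n. 16 * (?q 0 n)\<^sup>2 * ?q 1 n * ?q 2 n)
      \<longlonglongrightarrow> 16 * (1 / sqrt 12)\<^sup>2 * (1 / sqrt 12) * (1 / sqrt 12)"
    by (intro tendsto_intros c_shift_limit)
  moreover have "16 * (1 / sqrt 12)\<^sup>2 * (1 / sqrt 12) * (1 / sqrt 12) = (1 / 9 :: real)"
    by (simp add: power_divide)
  moreover have "16 * (?q 0 n)\<^sup>2 * ?q 1 n * ?q 2 n = beta n" for n
    by (simp add: beta_def power_divide power2_eq_square)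
  ultimately show ?thesis by (simp only:)
qed

text \<open>Chosen so that \<open>d (n + 2) / real n = gam n * c (n + 1)\<close> for
  \<open>n > 0\<close>: the growing factor \<open>c (n + 1)\<close> is left to be combined with
  \<open>P n / P (n + 2)\<close>.\<close>

definition gam :: "nat \<Rightarrow> real" where "gam n = 4 * c (n + 2) * c n / real n"

lemma gam_nonneg: "0 \<le> gam n" by (simp add: gam_def c_nonneg)

lemma gam_limit: "gam \<longlonglongrightarrow> 1 / 3"
proof -
  let ?q = "\<lambda>n. c n / sqrt (real n)"
  have q2: "(\<lambda>n. ?q (n + 2)) \<longlonglongrightarrow> 1 / sqrt 12"
    by (rule LIMSEQ_ignore_initial_segment[OF c_limit])
  have "(\<lambda>n. 4 * ?q (n + 2) * (sqrt (real n + 2) / sqrt (real n)) * ?q n)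
      \<longlonglongrightarrow> 4 * (1 / sqrt 12) * 1 * (1 / sqrt 12)"
    by (intro tendsto_intros c_limit q2) real_asymp
  moreover have "4 * (1 / sqrt 12) * 1 * (1 / sqrt 12) = (1 / 3 :: real)" by simp
  moreover have "4 * ?q (n + 2) * (sqrt (real n + 2) / sqrt (real n)) * ?q n = gam n" for n
    by (simp add: gam_def add.commute)
  ultimately show ?thesis by simp
qed

end

section \<open>Ratio asymptotics off the real line\<close>

lemma cpoly_add: "cpoly (p + q) z = cpoly p z + cpoly q z"
proof -
  have "map_poly complex_of_real (p + q) = map_poly complex_of_real p + map_poly complex_of_real q"
    by (rule poly_eqI) (simp add: coeff_map_poly)
  then show ?thesis by simp
qed

lemma cpoly_smult: "cpoly (smult a p) z = complex_of_real a * cpoly p z"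
  by (simp add: map_poly_smult)

lemma cpoly_diff: "cpoly (p - q) z = cpoly p z - cpoly q z"
  using cpoly_add[of p "smult (-1) q" z] cpoly_smult[of "-1" q z] by simp

lemma cpoly_pCons_0: "cpoly (pCons 0 p) z = z * cpoly p z"
  by (simp add: map_poly_pCons)

context freud_ortho
begin

abbreviation CP :: "nat \<Rightarrow> complex \<Rightarrow> complex" where "CP n \<equiv> cpoly (P n)"

lemma CP_0: "CP 0 z = 1" by (simp add: P_0)

lemma CP_Suc: "CP (Suc n) z = z * CP n z - complex_of_real (c n) * CP (n - 1) z"
  using arg_cong[OF P_rec[of n], of "\<lambda>p. cpoly p z"]
  by (simp add: cpoly_pCons_0 cpoly_add cpoly_smult)

text \<open>The squared modulus of the orthonormal polynomial at \<open>z\<close>; its partial sums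
  are the Christoffel-Darboux kernel at \<open>z\<close> and its conjugate.\<close>

definition sq :: "complex \<Rightarrow> nat \<Rightarrow> real" where "sq z n = (cmod (CP n z))\<^sup>2 / h n"

lemma sq_nonneg: "0 \<le> sq z n" by (simp add: sq_def h_pos less_imp_le)

text \<open>Christoffel--Darboux at the pair \<open>z\<close>, \<open>cnj z\<close>.\<close>

lemma Im_CP_Suc_cnj: "Im (CP (Suc n) z * cnj (CP n z)) = Im z * h n * (\<Sum>j\<le>n. sq z j)"
proof (induction n)
  case 0
  then show ?case using h_pos[of 0] by (simp add: CP_Suc CP_0 sq_def)
next
  case (Suc n)
  have "Im (CP (Suc (Suc n)) z * cnj (CP (Suc n) z))
      = Im z * (cmod (CP (Suc n) z))\<^sup>2 + c (Suc n) * Im (CP (Suc n) z * cnj (CP n z))"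
    by (subst CP_Suc) (simp add: cmod_power2, simp add: algebra_simps power2_eq_square)
  also have "\<dots> = Im z * h (Suc n) * sq z (Suc n) + Im z * h (Suc n) * (\<Sum>j\<le>n. sq z j)"
    using h_pos[of n] c_pos[of "Suc n"] unfolding Suc by (simp add: sq_def h_Suc[of n])
  finally show ?case by (simp add: algebra_simps)
qed

lemma CP_prod_lower:
  "\<bar>Im z\<bar> * h n * (\<Sum>j\<le>n. sq z j) \<le> cmod (CP (Suc n) z) * cmod (CP n z)"
proof -
  have "\<bar>Im z\<bar> * h n * (\<Sum>j\<le>n. sq z j) = \<bar>Im (CP (Suc n) z * cnj (CP n z))\<bar>"
    unfolding Im_CP_Suc_cnj using h_pos[of n] by (simp add: abs_mult sum_nonneg sq_nonneg)
  also have "\<dots> \<le> cmod (CP (Suc n) z * cnj (CP n z))" by (rule abs_Im_le_cmod)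
  finally show ?thesis by (simp add: norm_mult)
qed

text \<open>The kernel contains the positive term \<open>sq z 0\<close>, so the lower bound for the
  product of two consecutive polynomials excludes zeros off the axis.\<close>

lemma CP_nonzero:
  assumes "Im z \<noteq> 0"
  shows "CP n z \<noteq> 0"
proof -
  have "0 < sq z 0" by (simp add: sq_def CP_0 h_pos)
  also have "\<dots> \<le> (\<Sum>j\<le>n. sq z j)" by (rule member_le_sum) (auto simp: sq_nonneg)
  finally have "0 < \<bar>Im z\<bar> * h n * (\<Sum>j\<le>n. sq z j)" using assms h_pos by simp
  then show ?thesis using CP_prod_lower[of z n] by auto
qed

text \<open>The smaller the share of the last term in the kernel, the smaller the ratio.
  \<open>M = 1\<close> is always available; \<open>sum_sq_dominates\<close> supplies arbitrarily
  large \<open>M\<close>.\<close>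

lemma CP_ratio_bound:
  assumes z: "Im z \<noteq> 0" and M: "0 < M" "M * sq z n \<le> (\<Sum>j\<le>n. sq z j)"
  shows "cmod (CP n z / CP (Suc n) z) \<le> 1 / (M * \<bar>Im z\<bar>)"
proof -
  have "\<bar>Im z\<bar> * h n * (M * sq z n) \<le> cmod (CP (Suc n) z) * cmod (CP n z)"
    using M(2) h_pos[of n] by (intro order.trans[OF mult_left_mono CP_prod_lower]) simp_all
  then have "(M * \<bar>Im z\<bar> * cmod (CP n z)) * cmod (CP n z) \<le> cmod (CP (Suc n) z) * cmod (CP n z)"
    using h_pos[of n] by (simp add: sq_def power2_eq_square mult_ac)
  then have "M * \<bar>Im z\<bar> * cmod (CP n z) \<le> cmod (CP (Suc n) z)"
    using CP_nonzero[OF z, of n] by simp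
  then show ?thesis
    using M z CP_nonzero[OF z, of "Suc n"] by (simp add: norm_divide divide_simps mult_ac)
qed

lemma CP_ratio_bound_1:
  assumes "Im z \<noteq> 0"
  shows "cmod (CP n z / CP (Suc n) z) \<le> 1 / \<bar>Im z\<bar>"
  using CP_ratio_bound[OF assms, of 1 n] member_le_sum[of n "{..n}" "sq z"] by (simp add: sq_nonneg)

definition abs_p :: "complex \<Rightarrow> nat \<Rightarrow> real" where "abs_p z n = sqrt (sq z n)"

lemma abs_p_nonneg: "0 \<le> abs_p z n" by (simp add: abs_p_def sq_nonneg)

lemma abs_p_power2: "(abs_p z n)\<^sup>2 = sq z n" by (simp add: abs_p_def sq_nonneg)

lemma abs_p_eq: "abs_p z n = cmod (CP n z) / sqrt (h n)"
  by (simp add: abs_p_def sq_def real_sqrt_divide)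

text \<open>The triangle inequality for the recurrence in orthonormal form,
  \<open>sqrt c_{n+2} p_{n+2} = z p_{n+1} - sqrt c_{n+1} p_n\<close>.\<close>

lemma abs_p_step: "sqrt (c (n + 2)) * abs_p z (n + 2) \<le> cmod z * abs_p z (n + 1) + sqrt (c (n + 1)) * abs_p z n"
proof -
  have "cmod (CP (Suc (Suc n)) z) \<le> cmod z * cmod (CP (Suc n) z) + c (Suc n) * cmod (CP n z)"
    unfolding CP_Suc[of "Suc n"] using c_nonneg[of "Suc n"]
    by (intro order.trans[OF norm_triangle_ineq4]) (simp add: norm_mult)
  then have "cmod (CP (Suc (Suc n)) z) / sqrt (h (Suc n))
      \<le> (cmod z * cmod (CP (Suc n) z) + c (Suc n) * cmod (CP n z)) / sqrt (h (Suc n))"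
    using h_pos[of "Suc n"] by (intro divide_right_mono) auto
  also have "\<dots> = cmod z * abs_p z (n + 1) + sqrt (c (n + 1)) * abs_p z n"
  proof -
    define a b where "a = sqrt (c (Suc n))" and "b = sqrt (h n)"
    have ab: "0 < a" "0 < b" "c (Suc n) = a * a" "sqrt (h (Suc n)) = a * b"
      using c_pos[of "Suc n"] h_pos[of n] by (simp_all add: a_def b_def h_Suc real_sqrt_mult)
    then show ?thesis
      by (simp add: abs_p_eq a_def[symmetric] b_def[symmetric] field_simps)
  qed
  also have "cmod (CP (Suc (Suc n)) z) / sqrt (h (Suc n)) = sqrt (c (n + 2)) * abs_p z (n + 2)"
    using c_pos[of "n + 2"] by (simp add: abs_p_eq h_Suc[of "Suc n"] real_sqrt_mult)
  finally show ?thesis .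
qed

text \<open>If the last term were not negligible in the sum, then \<open>abs_p z (n - 2 * i)\<close> would be comparable
  to \<open>abs_p z n\<close> for arbitrarily many \<open>i\<close>, because the recurrence coefficients tend to infinity with
  consecutive quotients tending to \<open>1\<close>.\<close>

lemma abs_p_persistence:
  assumes R: "\<And>z. z \<in> K \<Longrightarrow> cmod z \<le> R" and M: "0 < M" and "0 < \<eta>"
  shows "\<forall>\<^sub>F n in sequentially. \<forall>z\<in>K. (\<Sum>j\<le>n. sq z j) \<le> M * sq z n \<longrightarrow>
           (1 - \<eta>) * abs_p z n \<le> abs_p z (n - 2 * i)"
  using \<open>0 < \<eta>\<close>
proof (induction i arbitrary: \<eta>)
  case 0
  then show ?case by (simp add: algebra_simps abs_p_nonneg)
next
  case (Suc i)
  \<comment> \<open>The factor obtained by solving \<open>abs_p_step\<close> for its lowest term.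
    Half of \<eta> goes to the induction hypothesis, the other half absorbs the convergence of
    \<open>?r\<close> to \<open>1 - \<eta> / 2\<close>.\<close>
  let ?r = "\<lambda>n. (1 - \<eta> / 2) * sqrt (c n / c (n - 1)) - R * sqrt M / sqrt (c (n - 1))"
  have "(\<lambda>n. R * sqrt M / sqrt (c (n - 1))) \<longlonglongrightarrow> 0"
    by (intro tendsto_divide_0[OF tendsto_const] filterlim_at_top_imp_at_infinity
        filterlim_compose[OF sqrt_at_top] filterlim_compose[OF c_at_top] filterlim_minus_const_nat_at_top)
  then have "?r \<longlonglongrightarrow> (1 - \<eta> / 2) * sqrt 1 - 0"
    by (intro tendsto_intros c_ratio_limit)
  then have "\<forall>\<^sub>F n in sequentially. 1 - \<eta> < ?r n"
    using Suc.prems by (intro order_tendstoD) auto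
  then have "\<forall>\<^sub>F n in sequentially. 1 - \<eta> < ?r (n - 2 * i)"
    by (rule eventually_compose_filterlim) (rule filterlim_minus_const_nat_at_top)
  moreover have "\<forall>\<^sub>F n in sequentially. \<forall>z\<in>K. (\<Sum>j\<le>n. sq z j) \<le> M * sq z n \<longrightarrow>
      (1 - \<eta> / 2) * abs_p z n \<le> abs_p z (n - 2 * i)"
    using Suc.prems by (intro Suc.IH) simp
  moreover have "\<forall>\<^sub>F n in sequentially. 2 * i + 2 \<le> n" by (rule eventually_ge_at_top)
  ultimately show ?case
  proof eventually_elim
    case (elim n)
    show ?case
    proof (intro ballI impI)
      fix z assume z: "z \<in> K" and bad: "(\<Sum>j\<le>n. sq z j) \<le> M * sq z n"
      define m where "m = n - 2 * Suc i"
      have m: "n - 2 * i = m + 2" "m + 1 \<le> n" using elim(3) by (auto simp: m_def)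
      \<comment> \<open>The intermediate term is a summand of the kernel, hence comparable to the
        last one; division by the growing \<open>sqrt (c (m + 1))\<close> makes its contribution
        small.\<close>
      have "sq z (m + 1) \<le> M * sq z n"
        using m(2) by (intro order.trans[OF member_le_sum bad]) (auto simp: sq_nonneg)
      then have "sqrt (sq z (m + 1)) \<le> sqrt (M * sq z n)" by (rule real_sqrt_le_mono)
      then have q1: "abs_p z (m + 1) \<le> sqrt M * abs_p z n" by (simp add: abs_p_def real_sqrt_mult)
      define a where "a = sqrt (c (m + 1))"
      have a: "0 < a" using c_pos[of "m + 1"] by (simp add: a_def)
      have "sqrt (c (m + 2)) * ((1 - \<eta> / 2) * abs_p z n) \<le> sqrt (c (m + 2)) * abs_p z (m + 2)"
        using elim(2) z bad m(1) c_nonneg by (intro mult_left_mono) auto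
      also have "\<dots> \<le> cmod z * abs_p z (m + 1) + a * abs_p z m"
        unfolding a_def by (rule abs_p_step)
      also have "\<dots> \<le> R * (sqrt M * abs_p z n) + a * abs_p z m"
        using R[OF z] q1 abs_p_nonneg[of z] a
        by (intro add_mono mult_mono) (auto intro: order.trans[OF norm_ge_zero])
      finally have "(sqrt (c (m + 2)) * ((1 - \<eta> / 2) * abs_p z n) - R * (sqrt M * abs_p z n)) / a \<le> abs_p z m"
        using a by (simp add: pos_divide_le_eq mult.commute[of a])
      then have "(1 - \<eta> / 2) * (sqrt (c (m + 2)) / a) * abs_p z n - R * sqrt M / a * abs_p z n \<le> abs_p z m"
        by (simp add: diff_divide_distrib mult_ac)
      moreover have "(1 - \<eta>) * abs_p z n \<le> ?r (m + 2) * abs_p z n"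
        using elim(1) abs_p_nonneg[of z n] unfolding m(1) by (intro mult_right_mono) auto
      ultimately have "(1 - \<eta>) * abs_p z n \<le> abs_p z m"
        by (simp add: left_diff_distrib real_sqrt_divide a_def)
      then show "(1 - \<eta>) * abs_p z n \<le> abs_p z (n - 2 * Suc i)" by (simp only: m_def)
    qed
  qed
qed

text \<open>Otherwise persistence with \<eta> = 1/2 makes each of the \<open>J + 1\<close> distinct
  indices \<open>n - 2 * i\<close> contribute at least a quarter of \<open>sq z n\<close>, which is
  too much once \<open>4 * M \<le> J\<close>.\<close>

lemma sum_sq_dominates:
  assumes R: "\<And>z. z \<in> K \<Longrightarrow> cmod z \<le> R" and K: "\<And>z. z \<in> K \<Longrightarrow> Im z \<noteq> 0" and M: "0 < M"
  shows "\<forall>\<^sub>F n in sequentially. \<forall>z\<in>K. M * sq z n \<le> (\<Sum>j\<le>n. sq z j)"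
proof -
  obtain J :: nat where J: "4 * M \<le> real J" using real_arch_simple by blast
  have "\<forall>\<^sub>F n in sequentially. \<forall>i\<in>{..J}. \<forall>z\<in>K. (\<Sum>j\<le>n. sq z j) \<le> M * sq z n \<longrightarrow>
           (1 - 1 / 2) * abs_p z n \<le> abs_p z (n - 2 * i)"
    by (intro eventually_ball_finite ballI abs_p_persistence[OF R M]) auto
  moreover have "\<forall>\<^sub>F n in sequentially. 2 * J \<le> n" by (rule eventually_ge_at_top)
  ultimately show ?thesis
  proof eventually_elim
    case (elim n)
    show ?case
    proof (intro ballI, rule ccontr)
      fix z assume z: "z \<in> K" and "\<not> M * sq z n \<le> (\<Sum>j\<le>n. sq z j)"
      then have bad: "(\<Sum>j\<le>n. sq z j) < M * sq z n" by simp
      have "sq z n / 4 \<le> sq z (n - 2 * i)" if "i \<le> J" for i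
      proof -
        have "(1 - 1 / 2) * abs_p z n \<le> abs_p z (n - 2 * i)" using elim(1) z bad that by auto
        then have "((1 / 2) * abs_p z n)\<^sup>2 \<le> (abs_p z (n - 2 * i))\<^sup>2"
          using abs_p_nonneg by (intro power_mono) auto
        then show ?thesis by (simp add: power_mult_distrib abs_p_power2 power_divide)
      qed
      then have "(\<Sum>i\<le>J. sq z n / 4) \<le> (\<Sum>i\<le>J. sq z (n - 2 * i))" by (intro sum_mono) simp
      also have "\<dots> = sum (sq z) ((\<lambda>i. n - 2 * i) ` {..J})"
        using elim(2) by (subst sum.reindex) (auto simp: inj_on_def)
      also have "\<dots> \<le> (\<Sum>j\<le>n. sq z j)" by (intro sum_mono2) (auto simp: sq_nonneg)
      also have "\<dots> < M * sq z n" by (rule bad)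
      finally have "(real J + 1) / 4 * sq z n < M * sq z n" by (simp add: algebra_simps)
      moreover have "0 < sq z n"
        using bad M sum_nonneg[of "{..n}" "sq z"] sq_nonneg[of z n]
        by (metis less_eq_real_def mult_zero_right not_less sq_nonneg)
      ultimately have "(real J + 1) / 4 < M" by (simp only: mult_less_cancel_right_pos)
      then show False using J by simp
    qed
  qed
qed

lemma CP_ratio_limit:
  assumes R: "\<And>z. z \<in> K \<Longrightarrow> cmod z \<le> R" and \<delta>: "0 < \<delta>" "\<And>z. z \<in> K \<Longrightarrow> \<delta> \<le> \<bar>Im z\<bar>"
    and \<epsilon>: "0 < \<epsilon>"
  shows "\<forall>\<^sub>F n in sequentially. \<forall>z\<in>K. cmod (CP n z / CP (Suc n) z) \<le> \<epsilon>"
proof -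
  define M where "M = 1 / (\<delta> * \<epsilon>)"
  have M: "0 < M" using \<delta> \<epsilon> by (simp add: M_def)
  have nz: "Im z \<noteq> 0" if "z \<in> K" for z using \<delta>(1) \<delta>(2)[OF that] by auto
  have "\<forall>\<^sub>F n in sequentially. \<forall>z\<in>K. M * sq z n \<le> (\<Sum>j\<le>n. sq z j)"
    by (rule sum_sq_dominates) (use R nz M in auto)
  then show ?thesis
  proof (rule eventually_mono, intro ballI)
    fix n z assume *: "\<forall>z\<in>K. M * sq z n \<le> (\<Sum>j\<le>n. sq z j)" and z: "z \<in> K"
    have "cmod (CP n z / CP (Suc n) z) \<le> 1 / (M * \<bar>Im z\<bar>)"
      using * z nz M by (intro CP_ratio_bound) auto
    also have "\<dots> \<le> 1 / (M * \<delta>)"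
      using M \<delta> z by (intro divide_left_mono mult_left_mono) (auto intro!: mult_pos_pos nz simp: nz)
    also have "\<dots> = \<epsilon>" using \<delta> \<epsilon> by (simp add: M_def)
    finally show "cmod (CP n z / CP (Suc n) z) \<le> \<epsilon>" .
  qed
qed

end

section \<open>Limits along triangular arrays\<close>

text \<open>In the applications \<open>D n j\<close> is the error at index \<open>n - 2 j\<close> of a recurrence whose parameter is
  tied to the final index \<open>n\<close>.\<close>

lemma triangular_contraction:
  fixes D :: "nat \<Rightarrow> nat \<Rightarrow> 'a \<Rightarrow> real"
  assumes \<theta>: "0 \<le> \<theta>" "\<theta> < 1"
    and bound: "\<And>n j z. z \<in> K \<Longrightarrow> D n j z \<le> M"
    and step: "\<And>j \<epsilon>. 0 < \<epsilon> \<Longrightarrow> \<forall>\<^sub>F n in sequentially. \<forall>z\<in>K. D n j z \<le> \<theta> * D n (Suc j) z + \<epsilon>"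
    and \<epsilon>: "0 < \<epsilon>"
  shows "\<forall>\<^sub>F n in sequentially. \<forall>z\<in>K. D n j z \<le> \<epsilon>"
proof -
  \<comment> \<open>The number \<open>k\<close> of iterations is fixed before \<open>n\<close>
    grows, so only finitely many eventual bounds are combined and their thresholds may depend on
    \<open>j\<close>.\<close>
  have iter: "\<forall>\<^sub>F n in sequentially. \<forall>z\<in>K. D n j z \<le> \<theta> ^ k * M + \<epsilon>" if "0 < \<epsilon>" for k j \<epsilon>
    using that
  proof (induction k arbitrary: j \<epsilon>)
    case 0
    have "D n j z \<le> M + \<epsilon>" if "z \<in> K" for n z using bound[OF that, of n j] 0 by simp
    then show ?case by simp
  next
    case (Suc k)
    have "\<forall>\<^sub>F n in sequentially. \<forall>z\<in>K. D n j z \<le> \<theta> * D n (Suc j) z + \<epsilon> / 2"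
      using Suc.prems by (intro step) simp
    moreover have "\<forall>\<^sub>F n in sequentially. \<forall>z\<in>K. D n (Suc j) z \<le> \<theta> ^ k * M + \<epsilon> / 2"
      using Suc.prems by (intro Suc.IH) simp
    ultimately show ?case
    proof eventually_elim
      case (elim n)
      show ?case
      proof
        fix z assume z: "z \<in> K"
        have "\<theta> * D n (Suc j) z \<le> \<theta> * (\<theta> ^ k * M + \<epsilon> / 2)"
          using elim(2) z \<theta> by (intro mult_left_mono) auto
        moreover have "\<theta> * (\<epsilon> / 2) \<le> 1 * (\<epsilon> / 2)"
          using Suc.prems \<theta> by (intro mult_right_mono) auto
        ultimately show "D n j z \<le> \<theta> ^ Suc k * M + \<epsilon>"
          using elim(1) z by (fastforce simp: distrib_left)
      qed
    qed
  qed
  have "(\<lambda>k. \<theta> ^ k * M) \<longlonglongrightarrow> 0"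
    using tendsto_mult_right[OF LIMSEQ_realpow_zero[OF \<theta>], of M] by simp
  then have "\<forall>\<^sub>F k in sequentially. \<theta> ^ k * M < \<epsilon> / 2" using \<epsilon> by (intro order_tendstoD) auto
  then obtain k where k: "\<theta> ^ k * M < \<epsilon> / 2" by (auto simp: eventually_sequentially)
  have "\<forall>\<^sub>F n in sequentially. \<forall>z\<in>K. D n j z \<le> \<theta> ^ k * M + \<epsilon> / 2" using \<epsilon> by (intro iter) simp
  then show ?thesis by (rule eventually_mono) (use k in fastforce)
qed

text \<open>The value of \<open>t\<close> solves \<open>1 / t = 1 + (1 - t) / 9 + 1 / (sqrt 12 L)\<close>, which for \<open>u = 3 / t\<close> reads
  \<open>u + 1 / u = 2 (20 L + 3 sqrt 3) / (12 L)\<close>.\<close>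

lemma joukowski_fixed_point:
  assumes l: "0 < l"
  defines "u \<equiv> joukowski_phi ((20 * l + 3 * sqrt 3) / (12 * l))"
  shows "3 \<le> u" and "u / 3 = 1 + (1 - 3 / u) / 9 + 1 / (sqrt 12 * l)"
proof -
  define w where "w = (20 * l + 3 * sqrt 3) / (12 * l)"
  have w: "w = 5 / 3 + sqrt 3 / (4 * l)" using l by (simp add: w_def field_simps)
  then have w53: "5 / 3 \<le> w" using l by simp
  then have w2: "(5 / 3)\<^sup>2 \<le> w\<^sup>2" by (intro power_mono) auto
  have u: "u = w + sqrt (w\<^sup>2 - 1)" by (simp add: u_def joukowski_phi_def w_def)
  \<comment> \<open>\<open>(5/3)^2 - 1 = (4/3)^2\<close>, and \<open>5/3\<close> is the limit of
    \<open>w\<close> as \<open>l\<close> grows.\<close>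
  have "sqrt ((4 / 3)\<^sup>2) \<le> sqrt (w\<^sup>2 - 1)"
    using w2 by (intro real_sqrt_le_mono) (simp add: power2_eq_square)
  then have "4 / 3 \<le> sqrt (w\<^sup>2 - 1)" by simp
  then show u3: "3 \<le> u" using w53 u by linarith
  \<comment> \<open>The conjugate expression is the reciprocal of \<open>u\<close>, so
    \<open>u + 1 / u = 2 * w\<close>.\<close>
  have "u * (w - sqrt (w\<^sup>2 - 1)) = w\<^sup>2 - (sqrt (w\<^sup>2 - 1))\<^sup>2"
    unfolding u by (simp add: algebra_simps power2_eq_square)
  also have "(sqrt (w\<^sup>2 - 1))\<^sup>2 = w\<^sup>2 - 1"
    using w2 by (intro real_sqrt_pow2) (simp add: power2_eq_square)
  finally have "w - sqrt (w\<^sup>2 - 1) = 1 / u" using u3 by (simp add: field_simps)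
  then have uw: "u + 1 / u = 2 * w" using u by linarith
  have s12: "sqrt 12 = 2 * sqrt 3" using real_sqrt_mult[of 4 3] by simp
  have "3 / sqrt 3 = sqrt 3" by (simp add: real_div_sqrt)
  then have "1 / (sqrt 12 * l) = sqrt 3 / (6 * l)"
    using l unfolding s12 by (simp add: field_simps)
  then show "u / 3 = 1 + (1 - 3 / u) / 9 + 1 / (sqrt 12 * l)"
    using uw unfolding w by (simp add: field_simps)
qed

section \<open>Limit of the normalised inverse norms along the array\<close>

context freud_ortho
begin

lemma filterlim_minus_twice: "filterlim (\<lambda>n. n - 2 * j) sequentially sequentially" for j :: nat
  by (rule filterlim_minus_const_nat_at_top)

text \<open>Splitting \<open>m^2\<close> as \<open>m^(1/2) * m^(3/2)\<close> isolates
  \<open>n^(3/2) * l\<close>, whose limit is given for \<open>l = lam n\<close>; the other factors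
  converge when \<open>n - m\<close> is fixed.\<close>

lemma perturbation_eq:
  assumes "0 < m" "m \<le> n"
  shows "c m / (l * (real m)\<^sup>2)
    = (c m / sqrt (real m)) * (real n / real m) powr (3/2) / (real n powr (3/2) * l)"
proof -
  have "(real m)\<^sup>2 = sqrt (real m) * real m powr (3/2)"
    using assms by (simp add: powr_half_sqrt[symmetric] powr_add[symmetric] powr_numeral)
  then show ?thesis using assms by (simp add: powr_divide)
qed

lemma ratio_powr_limit: "(\<lambda>n. (real n / real (n - 2 * j)) powr (3/2)) \<longlonglongrightarrow> 1"
proof -
  have "(\<lambda>n. (real n / (real n - 2 * real j)) powr (3/2)) \<longlonglongrightarrow> 1" by real_asymp
  then show ?thesis
    by (rule Lim_transform_eventually)
       (auto intro!: eventually_mono[OF eventually_ge_at_top[of "2 * j"]] simp: of_nat_diff)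
qed

lemma tau_eq:
  assumes "0 < n"
  shows "tau l n = 1 / (1 + beta n * (1 - tau l (n - 2)) + c n / (l * (real n)\<^sup>2))"
  using assms by (cases n) (simp_all del: of_nat_Suc)

text \<open>Both denominators are at least 1, so their reciprocals are no farther apart than they
  are. The error two indices earlier then enters with the factor 1/9, the limit of
  \<open>beta\<close>.\<close>

lemma tau_limit_pos:
  assumes lam: "\<And>n. 0 < lam n" and e0: "0 \<le> e"
    and e: "\<And>j. (\<lambda>n. c (n - 2 * j) / (lam n * (real (n - 2 * j))\<^sup>2)) \<longlonglongrightarrow> e"
    and t: "0 \<le> t" "t \<le> 1" "t = 1 / (1 + (1 - t) / 9 + e)"
  shows "(\<lambda>n. tau (lam n) (n - 2 * j)) \<longlonglongrightarrow> t"
proof -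
  define D where "D = (\<lambda>n j (_::unit). \<bar>tau (lam n) (n - 2 * j) - t\<bar>)"
  have tb: "0 \<le> tau (lam n) m" "tau (lam n) m \<le> 1" for n m using tau_bounds[OF lam] by auto
  have "\<forall>\<^sub>F n in sequentially. \<forall>z\<in>UNIV. D n j z \<le> \<epsilon>" if "0 < \<epsilon>" for \<epsilon>
  proof (rule triangular_contraction[where \<theta> = "1 / 9" and M = 1])
    show "D n j z \<le> 1" for n j z using tb[of n "n - 2 * j"] t by (simp add: D_def abs_le_iff)
    fix j and \<epsilon> :: real assume \<epsilon>: "0 < \<epsilon>"
    have "\<forall>\<^sub>F n in sequentially. \<bar>beta (n - 2 * j) - 1 / 9\<bar> < \<epsilon> / 2"
      using tendstoD[OF filterlim_compose[OF beta_limit filterlim_minus_twice[of j]], of "\<epsilon> / 2"] \<epsilon>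
      by (simp add: dist_real_def)
    moreover have "\<forall>\<^sub>F n in sequentially. \<bar>c (n - 2 * j) / (lam n * (real (n - 2 * j))\<^sup>2) - e\<bar> < \<epsilon> / 2"
      using tendstoD[OF e[of j], of "\<epsilon> / 2"] \<epsilon> by (simp add: dist_real_def)
    moreover have "\<forall>\<^sub>F n in sequentially. 2 * j < n" by (rule eventually_gt_at_top)
    ultimately show "\<forall>\<^sub>F n in sequentially. \<forall>z\<in>UNIV. D n j z \<le> 1 / 9 * D n (Suc j) z + \<epsilon>"
    proof eventually_elim
      case (elim n)
      define m where "m = n - 2 * j"
      define a where "a = tau (lam n) (m - 2)"
      define p where "p = c m / (lam n * (real m)\<^sup>2)"
      define X where "X = 1 + beta m * (1 - a) + p"
      define Y where "Y = 1 + (1 - t) / 9 + e"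
      have tri: "\<bar>x - y - w\<bar> \<le> \<bar>x\<bar> + \<bar>y\<bar> + \<bar>w\<bar>" for x y w :: real by linarith
      have a: "0 \<le> a" "a \<le> 1" using tb by (auto simp: a_def)
      have "0 \<le> p" using lam[of n] c_nonneg[of m] by (simp add: p_def)
      then have X: "1 \<le> X" using a beta_nonneg[of m] by (simp add: X_def)
      have Y: "1 \<le> Y" using t e0 by (simp add: Y_def)
      have "tau (lam n) m = 1 / X" using elim(3) tau_eq[of m "lam n"] by (simp add: m_def X_def a_def p_def)
      moreover have "t = 1 / Y" using t by (simp add: Y_def)
      ultimately have "tau (lam n) m - t = (Y - X) / (X * Y)" using X Y by (simp add: field_simps)
      then have "\<bar>tau (lam n) m - t\<bar> = \<bar>Y - X\<bar> / (X * Y)" using X Y by (simp add: abs_mult)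
      also have "\<dots> \<le> \<bar>Y - X\<bar> / 1"
        using X Y mult_mono[of 1 X 1 Y] by (intro divide_left_mono) auto
      also have "Y - X = (1 / 9) * (a - t) - (beta m - 1 / 9) * (1 - a) - (p - e)"
        by (simp add: X_def Y_def algebra_simps diff_divide_distrib)
      also have "\<bar>\<dots>\<bar> / 1 \<le> (1 / 9) * \<bar>a - t\<bar> + \<bar>(beta m - 1 / 9) * (1 - a)\<bar> + \<bar>p - e\<bar>"
        using tri[of "(1 / 9) * (a - t)" "(beta m - 1 / 9) * (1 - a)" "p - e"] by (simp add: abs_mult)
      finally have "\<bar>tau (lam n) m - t\<bar>
          \<le> (1 / 9) * \<bar>a - t\<bar> + \<bar>(beta m - 1 / 9) * (1 - a)\<bar> + \<bar>p - e\<bar>" .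
      moreover have "\<bar>(beta m - 1 / 9) * (1 - a)\<bar> \<le> \<bar>beta m - 1 / 9\<bar> * 1"
        unfolding abs_mult using a by (intro mult_left_mono) auto
      moreover have "\<bar>beta m - 1 / 9\<bar> < \<epsilon> / 2" "\<bar>p - e\<bar> < \<epsilon> / 2"
        using elim by (simp_all add: m_def p_def)
      ultimately have "\<bar>tau (lam n) m - t\<bar> \<le> 1 / 9 * \<bar>a - t\<bar> + \<epsilon>" by linarith
      then show ?case by (simp add: D_def m_def a_def)
    qed
  qed (use that in auto)
  then have "\<forall>\<^sub>F n in sequentially. dist (tau (lam n) (n - 2 * j)) t < \<epsilon>" if "0 < \<epsilon>" for \<epsilon>
    using that by (force simp: D_def dist_real_def dest!: spec[of _ "\<epsilon> / 2"] elim: eventually_mono)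
  then show ?thesis by (rule tendstoI)
qed

text \<open>The diverging perturbation alone bounds \<open>tau\<close> by its reciprocal, so the
  case \<open>L = 0\<close> needs no contraction.\<close>

lemma tau_limit_0:
  assumes lam: "\<And>n. 0 < lam n"
    and e: "filterlim (\<lambda>n. c (n - 2 * j) / (lam n * (real (n - 2 * j))\<^sup>2)) at_top sequentially"
  shows "(\<lambda>n. tau (lam n) (n - 2 * j)) \<longlonglongrightarrow> 0"
proof (rule tendsto_sandwich)
  let ?p = "\<lambda>n. c (n - 2 * j) / (lam n * (real (n - 2 * j))\<^sup>2)"
  show "\<forall>\<^sub>F n in sequentially. 0 \<le> tau (lam n) (n - 2 * j)" using tau_bounds[OF lam] by simp
  show "\<forall>\<^sub>F n in sequentially. tau (lam n) (n - 2 * j) \<le> 1 / ?p n"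
    using eventually_gt_at_top[of "2 * j"]
  proof eventually_elim
    case (elim n)
    define m where "m = n - 2 * j"
    have "0 \<le> beta m * (1 - tau (lam n) (m - 2))" using tau_bounds[OF lam] beta_nonneg by simp
    moreover have "0 < c m / (lam n * (real m)\<^sup>2)" using elim lam c_pos by (simp add: m_def)
    moreover have "tau (lam n) m
        = 1 / (1 + beta m * (1 - tau (lam n) (m - 2)) + c m / (lam n * (real m)\<^sup>2))"
      using elim by (intro tau_eq) (simp add: m_def)
    ultimately have "tau (lam n) m \<le> 1 / (c m / (lam n * (real m)\<^sup>2))"
      by (simp only:) (intro frac_le, auto)
    then show ?case by (simp only: m_def)
  qed
  show "(\<lambda>n. 1 / ?p n) \<longlonglongrightarrow> 0"
    by (rule tendsto_divide_0[OF tendsto_const filterlim_at_top_imp_at_infinity[OF e]])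
qed simp

text \<open>The perturbation tends to 0, to infinity or to \<open>1 / (sqrt 12 * L)\<close>
  according as \<open>L\<close> is infinite, zero or in between; the corresponding \<open>t\<close>
  is 1, 0 or \<open>3 / u\<close> with the Joukowski value \<open>u\<close>.\<close>

lemma tau_limit:
  assumes lam: "\<And>n. 0 < lam n" and L0: "0 \<le> L"
    and L: "(\<lambda>n. ereal (real n powr (3/2) * lam n)) \<longlonglongrightarrow> L"
  obtains t where "0 \<le> t" "t \<le> 1" "\<And>j. (\<lambda>n. tau (lam n) (n - 2 * j)) \<longlonglongrightarrow> t"
    "sobolev_ratio_limit L = 1 / (1 - t / 3)"
proof -
  let ?x = "\<lambda>n. real n powr (3/2) * lam n"
  let ?p = "\<lambda>j n. c (n - 2 * j) / (lam n * (real (n - 2 * j))\<^sup>2)"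
  let ?g = "\<lambda>j n. c (n - 2 * j) / sqrt (real (n - 2 * j)) * (real n / real (n - 2 * j)) powr (3/2)"
  have g: "?g j \<longlonglongrightarrow> 1 / sqrt 12" for j
    using tendsto_mult[OF filterlim_compose[OF c_limit filterlim_minus_twice[of j]] ratio_powr_limit[of j]]
    by simp
  have p: "\<forall>\<^sub>F n in sequentially. ?g j n / ?x n = ?p j n" for j
    using eventually_gt_at_top[of "2 * j"] by eventually_elim (subst perturbation_eq, auto)
  show thesis
  proof (cases L)
    case MInf
    then show ?thesis using L0 by simp
  next
    case PInf
    have "filterlim ?x at_top sequentially" using L PInf by (simp add: tendsto_PInfty_eq_at_top)
    then have "(\<lambda>n. ?g j n / ?x n) \<longlonglongrightarrow> 0" for j
      by (intro tendsto_divide_0[OF g] filterlim_at_top_imp_at_infinity)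
    then have "?p j \<longlonglongrightarrow> 0" for j by (rule Lim_transform_eventually[OF _ p])
    then have "(\<lambda>n. tau (lam n) (n - 2 * j)) \<longlonglongrightarrow> 1" for j
      by (intro tau_limit_pos[where e = 0] lam) auto
    then show ?thesis using PInf by (intro that[of 1]) (auto simp: sobolev_ratio_limit_def)
  next
    case (real l)
    then have xl: "?x \<longlonglongrightarrow> l" using L by simp
    show ?thesis
    proof (cases "l = 0")
      case True
      have "filterlim (\<lambda>n. ?g j n / ?x n) at_top sequentially" for j
      proof -
        have "\<forall>\<^sub>F n in sequentially. 0 < ?x n"
          using eventually_gt_at_top[of 0] by eventually_elim (simp add: lam)
        then have "filterlim (\<lambda>n. inverse (?x n)) at_top sequentially"
          using xl True by (intro filterlim_inverse_at_top) auto
        then have "filterlim (\<lambda>n. ?g j n * inverse (?x n)) at_top sequentially"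
          by (intro filterlim_tendsto_pos_mult_at_top[OF g]) auto
        then show ?thesis by (simp only: divide_inverse)
      qed
      then have "filterlim (?p j) at_top sequentially" for j
        by (rule filterlim_cong[OF refl refl p, THEN iffD1])
      then have "(\<lambda>n. tau (lam n) (n - 2 * j)) \<longlonglongrightarrow> 0" for j
        by (intro tau_limit_0 lam)
      then show ?thesis using True real by (intro that[of 0]) (auto simp: sobolev_ratio_limit_def)
    next
      case False
      then have l: "0 < l" using L0 real by simp
      define u where "u = joukowski_phi ((20 * l + 3 * sqrt 3) / (12 * l))"
      note u = joukowski_fixed_point[OF l, folded u_def]
      have "(\<lambda>n. ?g j n / ?x n) \<longlonglongrightarrow> (1 / sqrt 12) / l" for j
        using l by (intro tendsto_divide g xl) auto
      then have "?p j \<longlonglongrightarrow> 1 / (sqrt 12 * l)" for j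
        using Lim_transform_eventually[OF _ p] by force
      moreover have "3 / u = 1 / (1 + (1 - 3 / u) / 9 + 1 / (sqrt 12 * l))"
        unfolding u(2)[symmetric] by simp
      ultimately have "(\<lambda>n. tau (lam n) (n - 2 * j)) \<longlonglongrightarrow> 3 / u" for j
        using l u(1) by (intro tau_limit_pos[where e = "1 / (sqrt 12 * l)"] lam) auto
      moreover have "sobolev_ratio_limit L = 1 / (1 - (3 / u) / 3)"
        using real l by (simp add: sobolev_ratio_limit_def u_def inverse_eq_divide)
      ultimately show ?thesis using u(1) by (intro that[of "3 / u"]) auto
    qed
  qed
qed

section \<open>Quotients of Sobolev and standard orthogonal polynomials\<close>

definition ratio :: "real \<Rightarrow> complex \<Rightarrow> nat \<Rightarrow> complex" where
  "ratio l z n = cpoly (T l n) z / CP n z"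

text \<open>The three-term recurrence turns \<open>- c (n + 1) * CP n z / CP (n + 2) z\<close> into
  \<open>1 - z * CP (n + 1) z / CP (n + 2) z\<close>, which exhibits the coefficient as a
  perturbation of \<open>gam n * tau l n\<close>.\<close>

definition ratio_coeff :: "real \<Rightarrow> complex \<Rightarrow> nat \<Rightarrow> complex" where
  "ratio_coeff l z n = complex_of_real (gam n * tau l n) * (1 - z * (CP (n + 1) z / CP (n + 2) z))"

lemma ratio_0_1:
  assumes "Im z \<noteq> 0"
  shows "ratio l z 0 = 1" "ratio l z (Suc 0) = 1"
  using CP_nonzero[OF assms] by (simp_all add: ratio_def)

lemma ratio_step:
  assumes z: "Im z \<noteq> 0"
  shows "ratio l z (n + 2) = 1 + ratio_coeff l z n * ratio l z n"
proof -
  let ?a = "d (n + 2) * tau l n / real n"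
  have nz: "CP m z \<noteq> 0" for m by (rule CP_nonzero[OF z])
  have rec: "complex_of_real (c (n + 1)) * CP n z = - (CP (n + 2) z - z * CP (n + 1) z)"
    using CP_Suc[of "Suc n" z] by simp
  have "?a = gam n * tau l n * c (n + 1)"
    by (simp add: d_def gam_def mult_ac)
  then have "complex_of_real ?a * CP n z
      = complex_of_real (gam n * tau l n) * (complex_of_real (c (n + 1)) * CP n z)"
    by (simp only: of_real_mult mult_ac)
  also have "\<dots> = - (ratio_coeff l z n * CP (n + 2) z)"
    unfolding rec ratio_coeff_def using nz[of "n + 2"] by (simp add: field_simps)
  finally have a: "complex_of_real ?a * CP n z = - (ratio_coeff l z n * CP (n + 2) z)" .
  have "cpoly (T l (n + 2)) z = CP (n + 2) z - complex_of_real ?a * (ratio l z n * CP n z)"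
    using nz[of n] by (simp add: cpoly_diff cpoly_smult ratio_def)
  also have "complex_of_real ?a * (ratio l z n * CP n z) = ratio l z n * (complex_of_real ?a * CP n z)"
    by (simp only: mult_ac)
  finally have "cpoly (T l (n + 2)) z = CP (n + 2) z * (1 + ratio_coeff l z n * ratio l z n)"
    unfolding a by (simp add: algebra_simps)
  then show ?thesis
    unfolding ratio_def[of l z "n + 2"] by (simp only: nonzero_mult_div_cancel_left[OF nz])
qed

context
  fixes K :: "complex set" and R \<delta> :: real
  assumes R: "\<And>z. z \<in> K \<Longrightarrow> cmod z \<le> R"
    and \<delta>: "0 < \<delta>" "\<And>z. z \<in> K \<Longrightarrow> \<delta> \<le> \<bar>Im z\<bar>"
begin

lemma K_off_axis: "z \<in> K \<Longrightarrow> Im z \<noteq> 0"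
  using \<delta>(1) \<delta>(2)[of z] by auto

lemma ratio_coeff_dist:
  assumes z: "z \<in> K" and l: "0 < l"
  shows "cmod (ratio_coeff l z n - complex_of_real (gam n * tau l n))
      \<le> gam n * R * cmod (CP (n + 1) z / CP (n + 2) z)"
proof -
  have "ratio_coeff l z n - complex_of_real (gam n * tau l n)
      = - (complex_of_real (gam n * tau l n) * z * (CP (n + 1) z / CP (n + 2) z))"
    by (simp add: ratio_coeff_def algebra_simps)
  then have "cmod (ratio_coeff l z n - complex_of_real (gam n * tau l n))
      = gam n * tau l n * cmod z * cmod (CP (n + 1) z / CP (n + 2) z)"
    using tau_bounds[OF l, of n] gam_nonneg[of n]
    by (simp only: norm_minus_cancel norm_mult norm_of_real abs_of_nonneg mult_nonneg_nonneg)
  also have "\<dots> \<le> gam n * 1 * R * cmod (CP (n + 1) z / CP (n + 2) z)"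
    using tau_bounds[OF l, of n] gam_nonneg[of n] R[OF z]
    by (intro mult_right_mono mult_mono mult_left_mono mult_nonneg_nonneg) auto
  finally show ?thesis by simp
qed

lemma R_CP_ratio_limit:
  assumes "0 < \<epsilon>"
  shows "\<forall>\<^sub>F n in sequentially. \<forall>z\<in>K. R * cmod (CP (n + 1) z / CP (n + 2) z) \<le> \<epsilon>"
proof -
  define \<epsilon>' where "\<epsilon>' = \<epsilon> / (\<bar>R\<bar> + 1)"
  have "0 < \<epsilon>'" using assms by (simp add: \<epsilon>'_def)
  then have "\<forall>\<^sub>F n in sequentially. \<forall>z\<in>K. cmod (CP n z / CP (Suc n) z) \<le> \<epsilon>'"
    using CP_ratio_limit[of K R \<delta> \<epsilon>'] R \<delta> by blast
  then have "\<forall>\<^sub>F n in sequentially. \<forall>z\<in>K. cmod (CP (Suc n) z / CP (Suc (Suc n)) z) \<le> \<epsilon>'"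
    by (subst eventually_sequentially_Suc)
  then show ?thesis
  proof (rule eventually_mono, intro ballI)
    fix n z assume "\<forall>z\<in>K. cmod (CP (Suc n) z / CP (Suc (Suc n)) z) \<le> \<epsilon>'" and z: "z \<in> K"
    then have "R * cmod (CP (n + 1) z / CP (n + 2) z) \<le> (\<bar>R\<bar> + 1) * \<epsilon>'"
      by (intro mult_mono) auto
    also have "\<dots> = \<epsilon>" by (simp add: \<epsilon>'_def)
    finally show "R * cmod (CP (n + 1) z / CP (n + 2) z) \<le> \<epsilon>" .
  qed
qed

lemma ratio_coeff_bound:
  assumes z: "z \<in> K" and l: "0 < l"
  shows "cmod (ratio_coeff l z n) \<le> gam n * (1 + R * cmod (CP (n + 1) z / CP (n + 2) z))"
proof -
  have "cmod (ratio_coeff l z n) \<le> cmod (ratio_coeff l z n - complex_of_real (gam n * tau l n))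
      + cmod (complex_of_real (gam n * tau l n))"
    using norm_triangle_ineq[of "ratio_coeff l z n - complex_of_real (gam n * tau l n)"
        "complex_of_real (gam n * tau l n)"] by (simp del: of_real_mult)
  also have "cmod (complex_of_real (gam n * tau l n)) \<le> gam n * 1"
    using tau_bounds[OF l, of n] gam_nonneg[of n]
    by (simp only: norm_of_real abs_of_nonneg mult_nonneg_nonneg) (intro mult_left_mono, auto)
  also note ratio_coeff_dist[OF z l, of n]
  finally show ?thesis by (simp add: algebra_simps)
qed

lemma eventually_ratio_coeff_le_half:
  "\<forall>\<^sub>F n in sequentially. \<forall>z\<in>K. \<forall>l>0. cmod (ratio_coeff l z n) \<le> 1 / 2"
proof -
  \<comment> \<open>The constants satisfy \<open>(2/5) * (1 + 1/4) = 1/2\<close>, where 2/5 exceeds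
    the limit 1/3 of \<open>gam\<close>.\<close>
  have "\<forall>\<^sub>F n in sequentially. \<forall>z\<in>K. R * cmod (CP (n + 1) z / CP (n + 2) z) \<le> 1 / 4"
    by (rule R_CP_ratio_limit) simp
  moreover have "\<forall>\<^sub>F n in sequentially. gam n < 2 / 5"
    using gam_limit by (rule order_tendstoD) simp
  ultimately show ?thesis
  proof eventually_elim
    case (elim n)
    show ?case
    proof (intro ballI allI impI)
      fix z and l :: real assume z: "z \<in> K" and l: "0 < l"
      have "cmod (ratio_coeff l z n) \<le> gam n * (1 + R * cmod (CP (n + 1) z / CP (n + 2) z))"
        by (rule ratio_coeff_bound[OF z l])
      also have "\<dots> \<le> (2 / 5) * (1 + 1 / 4)"
        using elim z gam_nonneg[of n] order.trans[OF norm_ge_zero R[OF z]]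
        by (intro mult_mono) auto
      finally show "cmod (ratio_coeff l z n) \<le> 1 / 2" by simp
    qed
  qed
qed

text \<open>The bound 1/2 for the coefficients holds only for large indices; for the others the
  crude bound \<open>1 / \<delta>\<close> on consecutive ratios suffices, uniformly in
  \<open>l\<close>.\<close>

lemma ratio_bounded_at: "\<exists>B. \<forall>z\<in>K. \<forall>l>0. cmod (ratio l z n) \<le> B"
proof (induction n rule: less_induct)
  case (less n)
  consider "n = 0" | "n = Suc 0" | m where "n = m + 2"
    by (metis One_nat_def add_2_eq_Suc' old.nat.exhaust)
  then show ?case
  proof cases
    case 3
    then obtain B where B: "\<And>z l. z \<in> K \<Longrightarrow> 0 < l \<Longrightarrow> cmod (ratio l z m) \<le> B" using less[of m] by auto
    define C where "C = gam m * (1 + R * (1 / \<delta>))"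
    show ?thesis
    proof (intro exI ballI allI impI)
      fix z and l :: real assume z: "z \<in> K" and l: "0 < l"
      have R0: "0 \<le> R" using order.trans[OF norm_ge_zero R[OF z]] .
      have "cmod (CP (Suc m) z / CP (Suc (Suc m)) z) \<le> 1 / \<bar>Im z\<bar>"
        by (rule CP_ratio_bound_1[OF K_off_axis[OF z]])
      also have "\<dots> \<le> 1 / \<delta>" using \<delta>(1) \<delta>(2)[OF z] by (intro divide_left_mono) auto
      finally have "cmod (ratio_coeff l z m) \<le> C"
        unfolding C_def using R0 gam_nonneg[of m]
        by (intro order.trans[OF ratio_coeff_bound[OF z l]] mult_left_mono add_left_mono) auto
      then have "cmod (ratio_coeff l z m * ratio l z m) \<le> C * B"
        unfolding norm_mult using B[OF z l]
        by (intro mult_mono) (auto intro: order.trans[OF norm_ge_zero])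
      then show "cmod (ratio l z n) \<le> 1 + C * B"
        unfolding \<open>n = m + 2\<close> ratio_step[OF K_off_axis[OF z]]
        by (intro order.trans[OF norm_triangle_ineq]) simp
    qed
  qed (auto intro!: exI[of _ 1] simp: ratio_0_1 K_off_axis)
qed

text \<open>Any bound \<open>B \<ge> 2\<close> survives passing from \<open>x\<close> to
  \<open>1 + x / 2\<close>. The initial segment runs to \<open>N + 1\<close> because the recurrence
  advances by two.\<close>

lemma ratio_bounded:
  obtains B where "\<And>z l n. z \<in> K \<Longrightarrow> 0 < l \<Longrightarrow> cmod (ratio l z n) \<le> B"
proof -
  obtain N where N: "\<And>n z l. N \<le> n \<Longrightarrow> z \<in> K \<Longrightarrow> 0 < l \<Longrightarrow> cmod (ratio_coeff l z n) \<le> 1 / 2"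
    using eventually_ratio_coeff_le_half by (auto simp: eventually_sequentially)
  obtain f where f: "\<And>n z l. z \<in> K \<Longrightarrow> 0 < l \<Longrightarrow> cmod (ratio l z n) \<le> f n"
    using ratio_bounded_at by metis
  define B where "B = Max (insert 2 (f ` {..N + 1}))"
  have B2: "2 \<le> B" by (simp add: B_def)
  have fB: "f n \<le> B" if "n \<le> N + 1" for n using that unfolding B_def by (intro Max_ge) auto
  have "cmod (ratio l z n) \<le> B" if z: "z \<in> K" and l: "0 < l" for z l n
  proof (induction n rule: less_induct)
    case (less n)
    show ?case
    proof (cases "n \<le> N + 1")
      case True then show ?thesis using f[OF z l, of n] fB[of n] by linarith
    next
      case False
      then obtain m where n: "n = m + 2" and m: "N \<le> m"
        by (intro that[of "n - 2"]) auto
      have "cmod (ratio l z n) \<le> 1 + cmod (ratio_coeff l z m) * cmod (ratio l z m)"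
        unfolding n ratio_step[OF K_off_axis[OF z]]
        by (intro order.trans[OF norm_triangle_ineq]) (simp add: norm_mult)
      also have "\<dots> \<le> 1 + (1 / 2) * B"
        using N[OF m z l] less[of m] n by (intro add_left_mono mult_mono) auto
      finally show ?thesis using B2 by simp
    qed
  qed
  then show ?thesis by (rule that)
qed

lemma ratio_limit:
  assumes lam: "\<And>n. 0 < lam n" and t: "0 \<le> t" "t \<le> 1"
    and tau: "\<And>j. (\<lambda>n. tau (lam n) (n - 2 * j)) \<longlonglongrightarrow> t" and \<epsilon>: "0 < \<epsilon>"
  shows "\<forall>\<^sub>F n in sequentially. \<forall>z\<in>K. cmod (ratio (lam n) z n - complex_of_real (1 / (1 - t / 3))) \<le> \<epsilon>"
proof -
  define u where "u = 1 / (1 - t / 3)"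
  \<comment> \<open>\<open>u\<close> is the fixed point of the limiting recurrence; its upper bound
    3/2 is attained at \<open>t = 1\<close>.\<close>
  have u: "u = 1 + t / 3 * u" "1 \<le> u" "u \<le> 3 / 2" using t by (simp_all add: u_def field_simps)
  obtain B where B: "\<And>z l n. z \<in> K \<Longrightarrow> 0 < l \<Longrightarrow> cmod (ratio l z n) \<le> B" using ratio_bounded by blast
  define D where "D = (\<lambda>n j z. cmod (ratio (lam n) z (n - 2 * j) - complex_of_real u))"
  have "\<forall>\<^sub>F n in sequentially. \<forall>z\<in>K. D n 0 z \<le> \<epsilon>"
  proof (rule triangular_contraction[where \<theta> = "1 / 2" and M = "B + 3 / 2"])
    show "D n j z \<le> B + 3 / 2" if "z \<in> K" for n j z
      unfolding D_def using B[OF that lam, of n "n - 2 * j"] u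
      by (intro order.trans[OF norm_triangle_ineq4] add_mono) auto
    fix j and \<epsilon> :: real assume \<epsilon>: "0 < \<epsilon>"
    let ?f = "\<lambda>n. n - 2 * Suc j"
    have lim: "filterlim ?f sequentially sequentially" by (rule filterlim_minus_twice)
    have "(\<lambda>n. gam (?f n) * tau (lam n) (?f n)) \<longlonglongrightarrow> 1 / 3 * t"
      by (intro tendsto_mult tau filterlim_compose[OF gam_limit lim])
    then have "\<forall>\<^sub>F n in sequentially. dist (gam (?f n) * tau (lam n) (?f n)) (1 / 3 * t) < \<epsilon> / 4"
      using \<epsilon> by (intro tendstoD) auto
    moreover have "\<forall>\<^sub>F n in sequentially. \<forall>z\<in>K. \<forall>l>0. cmod (ratio_coeff l z (?f n)) \<le> 1 / 2"
      by (rule eventually_compose_filterlim[OF eventually_ratio_coeff_le_half lim])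
    moreover have "\<forall>\<^sub>F n in sequentially. \<forall>z\<in>K. R * cmod (CP (?f n + 1) z / CP (?f n + 2) z) \<le> \<epsilon> / 4"
      using \<epsilon> by (intro eventually_compose_filterlim[OF R_CP_ratio_limit lim]) simp
    moreover have "\<forall>\<^sub>F n in sequentially. gam (?f n) < 1"
      using eventually_compose_filterlim[OF order_tendstoD(2)[OF gam_limit, of 1] lim] by simp
    moreover have "\<forall>\<^sub>F n in sequentially. 2 * Suc j \<le> n" by (rule eventually_ge_at_top)
    ultimately show "\<forall>\<^sub>F n in sequentially. \<forall>z\<in>K. D n j z \<le> 1 / 2 * D n (Suc j) z + \<epsilon>"
    proof eventually_elim
      case (elim n)
      define m where "m = n - 2 * Suc j"
      have n: "n - 2 * j = m + 2" using elim(5) by (simp add: m_def)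
      show ?case
      proof
        fix z assume z: "z \<in> K"
        define b where "b = ratio_coeff (lam n) z m"
        have b: "cmod b \<le> 1 / 2" using elim(2) z lam by (simp add: b_def m_def)
        have "cmod (b - complex_of_real (gam m * tau (lam n) m)) \<le> 1 * (\<epsilon> / 4)"
          using elim(3,4) z ratio_coeff_dist[OF z lam, of n m] gam_nonneg[of m] R[OF z] unfolding b_def m_def[symmetric]
          by (elim order.trans, unfold mult.assoc, intro mult_mono) (auto simp: order.trans[OF norm_ge_zero])
        moreover have "cmod (complex_of_real (gam m * tau (lam n) m) - complex_of_real (t / 3)) < \<epsilon> / 4"
          unfolding of_real_diff[symmetric] norm_of_real
          using elim(1) by (simp add: m_def dist_real_def)
        ultimately have bt: "cmod (b - complex_of_real (t / 3)) \<le> \<epsilon> / 2"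
          using norm_triangle_ineq[of "b - complex_of_real (gam m * tau (lam n) m)"
              "complex_of_real (gam m * tau (lam n) m) - complex_of_real (t / 3)"] by simp
        \<comment> \<open>Subtracting the fixed-point equation splits the new error into
          \<open>b\<close> times the old error and the error of \<open>b\<close> times
          \<open>u\<close>.\<close>
        have "complex_of_real u = 1 + complex_of_real (t / 3) * complex_of_real u"
          using arg_cong[OF u(1), of complex_of_real] by simp
        then have "ratio (lam n) z (m + 2) - complex_of_real u
            = b * (ratio (lam n) z m - complex_of_real u) + (b - complex_of_real (t / 3)) * complex_of_real u"
          unfolding ratio_step[OF K_off_axis[OF z]] b_def[symmetric] by (simp add: algebra_simps)
        then have "D n j z \<le> cmod b * D n (Suc j) z + cmod (b - complex_of_real (t / 3)) * cmod (complex_of_real u)"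
          unfolding D_def n m_def[symmetric] by (metis norm_mult norm_triangle_ineq)
        also have "\<dots> \<le> 1 / 2 * D n (Suc j) z + (\<epsilon> / 2) * (3 / 2)"
          using b bt u \<epsilon> by (intro add_mono mult_mono) (auto simp: D_def)
        finally show "D n j z \<le> 1 / 2 * D n (Suc j) z + \<epsilon>" using \<epsilon> by simp
      qed
    qed
  qed (use \<epsilon> in auto)
  then show ?thesis by (simp add: D_def u_def)
qed

end

end

section \<open>Uniform convergence on compact sets off the real axis\<close>

theorem theorem1:
  fixes lam :: "nat \<Rightarrow> real"
    and P S :: "nat \<Rightarrow> real poly"
    and L :: ereal
    and K :: "complex set"
  assumes lam_pos: "\<And>n. 0 < lam n"
    and lam_dec: "decseq lam"
    and lam_diff: "(\<lambda>n. real n powr (7/4) * (lam (n - 2) - lam n)) \<longlonglongrightarrow> 0"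
    and lam_ratio: "(\<lambda>n. real n powr (1/4) * (lam (n - 2) / lam n - 1)) \<longlonglongrightarrow> 0"
    and L_nonneg: "0 \<le> L"
    and lam_lim: "(\<lambda>n. ereal (real n powr (3/2) * lam n)) \<longlonglongrightarrow> L"
    and P_orth: "\<And>n. monic_orthogonal n (P n)"
    and S_min: "\<And>n. sobolev_minimizer (lam n) n (S n)"
    and K_compact: "compact K"
    and K_sub: "K \<subseteq> - \<real>"
  shows "uniform_limit K (\<lambda>n z. cpoly (S n) z / cpoly (P n) z)
           (\<lambda>_. complex_of_real (sobolev_ratio_limit L)) sequentially"
proof -
  interpret freud_ortho P by standard (rule P_orth)
  have S: "S n = T (lam n) n" for n
    by (rule sobolev_minimizer_eq_T[OF lam_pos S_min])
  obtain R where R: "\<And>z. z \<in> K \<Longrightarrow> cmod z \<le> R"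
    using compact_imp_bounded[OF K_compact] by (auto simp: bounded_iff)
  \<comment> \<open>The minimum of the distance to the real axis over \<open>K\<close>, attained by
    compactness; any positive number serves when \<open>K\<close> is empty.\<close>
  obtain \<delta> where \<delta>: "0 < \<delta>" "\<And>z. z \<in> K \<Longrightarrow> \<delta> \<le> \<bar>Im z\<bar>"
  proof (cases "K = {}")
    case False
    have "continuous_on K (\<lambda>z. \<bar>Im z\<bar>)" by (intro continuous_intros)
    then obtain w where w: "w \<in> K" "\<And>z. z \<in> K \<Longrightarrow> \<bar>Im w\<bar> \<le> \<bar>Im z\<bar>"
      using continuous_attains_inf[OF K_compact False] by blast
    have "Im w \<noteq> 0" using w(1) K_sub by (auto simp: complex_is_Real_iff)
    then show ?thesis using w(2) by (intro that[of "\<bar>Im w\<bar>"]) auto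
  qed (auto intro: that[of 1])
  obtain t where t: "0 \<le> t" "t \<le> 1" "\<And>j. (\<lambda>n. tau (lam n) (n - 2 * j)) \<longlonglongrightarrow> t"
    and L: "sobolev_ratio_limit L = 1 / (1 - t / 3)"
    using tau_limit[OF lam_pos L_nonneg lam_lim] by blast
  show ?thesis
  proof (rule uniform_limitI)
    fix e :: real assume "0 < e"
    then have "\<forall>\<^sub>F n in sequentially. \<forall>z\<in>K.
        cmod (ratio (lam n) z n - complex_of_real (1 / (1 - t / 3))) \<le> e / 2"
      by (intro ratio_limit[where R = R and \<delta> = \<delta>]) (use R \<delta> lam_pos t in auto)
    then show "\<forall>\<^sub>F n in sequentially. \<forall>z\<in>K.
        dist (cpoly (S n) z / cpoly (P n) z) (complex_of_real (sobolev_ratio_limit L)) < e"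
      by (rule eventually_mono) (use \<open>0 < e\<close> in \<open>force simp: S L ratio_def dist_norm\<close>)
  qed
qed

end
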